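(* Let $\{\mathbf w^k=(\mathbf x^k,\mathbf y^k,\boldsymbol\lambda^k)\}$ be iterates of the unified inexact stochastic ADMM described in the context, satisfying the $\mathbf y$-update conditions and the $\mathbf x$-inexact criteria stated there. Suppose that (A1), (A2), (A3) hold, that the augmented Lagrangian $\mathcal L_\beta$ is bounded below, and that the parameters are chosen such that $$\frac{1+\tau}{s\beta\sigma_A}\psi_1(s)\left(2L_f^2+4c_x^2\beta^2\right)+\widehat A-\frac{\beta}{2}\sigma_{\min}(\mathcal D_x^k)\le -w,\qquad 2\widehat A-\frac{\beta}{2}\sigma_{\min}(\mathcal D_y^k)\le -w ,$$ where $w>0$, $\tau\in(0,1)$, $\widehat A=4\frac{1+\tau}{s\beta\sigma_A}\psi_1(s)c_x^2\beta^2$, and $\sigma_{\min}(\mathcal D_x^k)$, $\sigma_{\min}(\mathcal D_y^k)$ are the smallest positive eigenvalues of $\mathcal D_x^k$ and $\mathcal D_y^k$. Then $$\min_{1\le k\le K}\mathbb E\left[\operatorname{dist}\left(\mathbf 0,\partial\mathcal L_\beta(\mathbf w^k)\right)^2\right]=\mathcal O(1/T),$$ where $T$ denotes the number of iterations ($T=K$).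
   Context: **Problem.** $\min_{\mathbf x\in\mathbb R^{n_x},\mathbf y\in\mathbb R^{n_y}} F(\mathbf x,\mathbf y)=f(\mathbf x)+g(\mathbf y)$ subject to $A\mathbf x+B\mathbf y=\mathbf b$, with $f=\frac1N\sum_{i=1}^N f_i$ smooth and nonconvex, $g$ locally Lipschitz continuous, possibly nonconvex and nonsmooth, $A\in\mathbb R^{m\times n_x}$, $B\in\mathbb R^{m\times n_y}$. $\partial g$ is the Clarke subgradient set. For $\beta>0$, $$\mathcal L_\beta(\mathbf x,\mathbf y,\boldsymbol\lambda)=f(\mathbf x)+g(\mathbf y)-\boldsymbol\lambda^\top(A\mathbf x+B\mathbf y-\mathbf b)+\tfrac\beta2\|A\mathbf x+B\mathbf y-\mathbf b\|^2,$$ and, with $\mathbf r=A\mathbf x+B\mathbf y-\mathbf b$, $\partial\mathcal L_\beta(\mathbf w)=\{\nabla f(\mathbf x)-A^\top\boldsymbol\lambda+\beta A^\top\mathbf r\}\times(\partial g(\mathbf y)-B^\top\boldsymbol\lambda+\beta B^\top\mathbf r)\times\{-\mathbf r\}$. **Assumptions.** (A1) $\nabla f$ is Lipschitz continuous with constant $L_f>0$. (A2) There exist $\sigma>0$ and a batch size $M$ such that $\mathbb E\|\nabla f(\mathbf x,\xi_M)-\nabla f(\mathbf x)\|^2\le\sigma^2/M$, where $\nabla f(\mathbf x,\xi_M)=\frac1M\sum_{i=1}^M\nabla f(\mathbf x,\xi_i)$ with i.i.d. $\xi_i$ and $\mathbb E[\nabla f(\mathbf x,\xi_i)]=\nabla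 f(\mathbf x)$. (A3) $\operatorname{Range}(B)\cup\{\mathbf b\}\subseteq\operatorname{Range}(A)$. **Algorithm (unified inexact stochastic ADMM).** Parameters $\beta>0$, $s\in(0,2)$, and an initial point $\mathbf w^0$; constants $c_x,\hat c_x,c_y>0$. $\|v\|_D^2=v^\top Dv$; $\mathcal F_k$ is the $\sigma$-field generated by the randomness of the first $k$ iterations and $\mathbb E_k=\mathbb E[\cdot\mid\mathcal F_k]$. At iteration $k=0,1,2,\dots$ choose bounded symmetric matrices $\mathcal D_x^k\succeq0$, $\mathcal D_y^k\succeq0$ with $\|\mathcal D_y^k\|\le c_y$, and then: (1) $\mathbf y^{k+1}=\arg\min_{\mathbf y}\mathcal L_\beta(\mathbf x^k,\mathbf y,\boldsymbol\lambda^k)+\frac\beta2\|\mathbf y-\mathbf y^k\|^2_{\mathcal D_y^k}$, which satisfies $\frac\beta2\|\mathbf y^{k+1}-\mathbf y^k\|^2_{\mathcal D_y^k}+\mathcal L_\beta(\mathbf x^k,\mathbf y^{k+1},\boldsymbol\lambda^k)\le\mathcal L_\beta(\mathbf x^k,\mathbf y^k,\boldsymbol\lambda^k)$ and $0\in\partial g(\mathbf y^{k+1})+\beta B^\top(A\mathbf x^k+B\mathbf y^{k+1}-\mathbf b-\boldsymbol\lambda^k/\beta)+\beta\mathcal D_y^k(\mathbf y^{k+1}-\mathbf y^k)$. (2) $\mathbf x^{k+1}$ is an approximate minimizer of $\langle\nabla f(\mathbf x^k,\xi_M),\mathbf x-\mathbf x^k\rangle+\frac\beta2\|A\mathbf x+B\mathbf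 y^{k+1}-\mathbf b-\boldsymbol\lambda^k/\beta\|^2+\frac\beta2\|\mathbf x-\mathbf x^k\|^2_{\mathcal D_x^k}$ satisfying, with $\xi_x^{k+1}=\nabla_{\mathbf x}\mathcal L_\beta(\mathbf x^{k+1},\mathbf y^{k+1},\boldsymbol\lambda^k)$, the inexact criteria $$\mathbb E_k[\mathcal L_\beta(\mathbf x^{k+1},\mathbf y^{k+1},\boldsymbol\lambda^k)]\le\mathcal L_\beta(\mathbf x^k,\mathbf y^{k+1},\boldsymbol\lambda^k)-\tfrac\beta2\mathbb E_k\|\mathbf x^{k+1}-\mathbf x^k\|^2_{\mathcal D_x^k}+\tfrac{(\hat c_x\beta)^2}{2}\tfrac{\sigma^2}{M},$$ $$\mathbb E_k\|\xi_x^{k+1}\|^2\le(c_x\beta)^2\,\mathbb E_k\Big(\tfrac{\sigma^2}{M}+\|\mathbf x^k-\mathbf x^{k+1}\|^2+\|\mathbf y^{k+1}-\mathbf y^k\|^2\Big).$$ (3) $\boldsymbol\lambda^{k+1}=\boldsymbol\lambda^k-s\beta(A\mathbf x^{k+1}+B\mathbf y^{k+1}-\mathbf b)$. **Notation.** $\sigma_A$ is the smallest positive eigenvalue of $A^\top A$; $\psi_1(s)=\max\{1,\frac{s^2}{(2-s)^2}\}$.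
   Formalization: The claim fails for a fixed batch size M or singular D_x^k, D_y^k; the formal statement adds T ≤ κM (any fixed κ>0, one constant for all M and T) and invertibility of D_x^k, D_y^k, and reads "bounded below" as along the iterates. *)

theory Defs
  imports "HOL-Probability.Probability"
begin

definition grad :: "('a::real_inner \<Rightarrow> real) \<Rightarrow> 'a \<Rightarrow> 'a" where
  "grad f x = (THE D. GDERIV f x :> D)"

definition locally_lipschitz :: "('a::metric_space \<Rightarrow> 'b::metric_space) \<Rightarrow> bool" where
  "locally_lipschitz g \<longleftrightarrow> (\<forall>y. \<exists>e>0. \<exists>L. L-lipschitz_on (ball y e) g)"

text \<open>Clarke's generalized directional derivative: the upper limit of the difference quotients
  as the base point tends to \<open>y\<close> (the value \<open>y\<close> itself being allowed) and the step size
  decreases to \<open>0\<close>.\<close>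

definition clarke_dderiv :: "('a::real_normed_vector \<Rightarrow> real) \<Rightarrow> 'a \<Rightarrow> 'a \<Rightarrow> ereal" where
  "clarke_dderiv g y d =
     Limsup (nhds y \<times>\<^sub>F at_right (0::real))
       (\<lambda>(z, t). ereal ((g (z + t *\<^sub>R d) - g z) / t))"

definition clarke_subdiff :: "('a::real_inner \<Rightarrow> real) \<Rightarrow> 'a \<Rightarrow> 'a set" where
  "clarke_subdiff g y = {v. \<forall>d. ereal (v \<bullet> d) \<le> clarke_dderiv g y d}"

definition is_eigenvalue :: "real ^ 'n ^ 'n \<Rightarrow> real \<Rightarrow> bool" where
  "is_eigenvalue D e \<longleftrightarrow> (\<exists>v. v \<noteq> 0 \<and> D *v v = e *\<^sub>R v)"

text \<open>Only meaningful for matrices that have a positive eigenvalue, such as a nonzero symmetric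
  positive semidefinite matrix.\<close>

definition smallest_pos_eigenvalue :: "real ^ 'n ^ 'n \<Rightarrow> real" where
  "smallest_pos_eigenvalue D = (LEAST e. 0 < e \<and> is_eigenvalue D e)"

definition sym_psd :: "real ^ 'n ^ 'n \<Rightarrow> bool" where
  "sym_psd D \<longleftrightarrow> transpose D = D \<and> (\<forall>v. 0 \<le> v \<bullet> (D *v v))"

text \<open>\<open>sq_norm_wrt D v\<close> is the squared seminorm of \<open>v\<close> induced by \<open>D\<close>.\<close>

definition sq_norm_wrt :: "real ^ 'n ^ 'n \<Rightarrow> real ^ 'n \<Rightarrow> real" where
  "sq_norm_wrt D v = v \<bullet> (D *v v)"

definition psi1 :: "real \<Rightarrow> real" where
  "psi1 s = max 1 (s\<^sup>2 / (2 - s)\<^sup>2)"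

definition residual ::
  "real ^ 'nx ^ 'm \<Rightarrow> real ^ 'ny ^ 'm \<Rightarrow> real ^ 'm \<Rightarrow> real ^ 'nx \<Rightarrow> real ^ 'ny \<Rightarrow> real ^ 'm" where
  "residual A B b x y = A *v x + B *v y - b"

definition aug_lagrangian ::
  "(real ^ 'nx \<Rightarrow> real) \<Rightarrow> (real ^ 'ny \<Rightarrow> real) \<Rightarrow> real ^ 'nx ^ 'm \<Rightarrow> real ^ 'ny ^ 'm \<Rightarrow>
   real ^ 'm \<Rightarrow> real \<Rightarrow> real ^ 'nx \<Rightarrow> real ^ 'ny \<Rightarrow> real ^ 'm \<Rightarrow> real" where
  "aug_lagrangian f g A B b \<beta> x y lam =
     f x + g y - lam \<bullet> residual A B b x y + \<beta> / 2 * (norm (residual A B b x y))\<^sup>2"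

definition subdiff_aug_lagrangian ::
  "(real ^ 'nx \<Rightarrow> real) \<Rightarrow> (real ^ 'ny \<Rightarrow> real) \<Rightarrow> real ^ 'nx ^ 'm \<Rightarrow> real ^ 'ny ^ 'm \<Rightarrow>
   real ^ 'm \<Rightarrow> real \<Rightarrow> real ^ 'nx \<Rightarrow> real ^ 'ny \<Rightarrow> real ^ 'm \<Rightarrow>
   ((real ^ 'nx) \<times> (real ^ 'ny) \<times> (real ^ 'm)) set" where
  "subdiff_aug_lagrangian f g A B b \<beta> x y lam =
     (let r = residual A B b x y in
        {grad f x - transpose A *v lam + \<beta> *\<^sub>R (transpose A *v r)}
        \<times> ((\<lambda>v. v - transpose B *v lam + \<beta> *\<^sub>R (transpose B *v r)) ` clarke_subdiff g y)
        \<times> {- r})"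

definition batch_grad ::
  "('a::real_vector \<Rightarrow> 's \<Rightarrow> 'a) \<Rightarrow> nat \<Rightarrow> 'a \<Rightarrow> (nat \<Rightarrow> 's) \<Rightarrow> 'a" where
  "batch_grad G M x \<zeta> = (1 / real M) *\<^sub>R (\<Sum>i<M. G x (\<zeta> i))"

text \<open>The stochastic gradient \<open>G x \<zeta>\<close>, with \<open>\<zeta>\<close> distributed according to \<open>\<Xi>\<close>, is an unbiased
  estimator of the gradient, and the variance of the average of \<open>M\<close> independent copies is at most
  \<open>\<sigma>\<^sup>2 / M\<close>.\<close>

definition bounded_variance_oracle ::
  "('a::euclidean_space \<Rightarrow> real) \<Rightarrow> ('a \<Rightarrow> 's \<Rightarrow> 'a) \<Rightarrow> 's measure \<Rightarrow> real \<Rightarrow> nat \<Rightarrow> bool" where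
  "bounded_variance_oracle f G \<Xi> \<sigma> M \<longleftrightarrow>
     (\<forall>x. integrable \<Xi> (G x) \<and> (\<integral>\<zeta>. G x \<zeta> \<partial>\<Xi>) = grad f x) \<and>
     (\<forall>x. (\<integral>\<^sup>+\<zeta>. ennreal ((norm (batch_grad G M x \<zeta> - grad f x))\<^sup>2) \<partial>(\<Pi>\<^sub>M i\<in>{..<M}. \<Xi>))
            \<le> ennreal (\<sigma>\<^sup>2 / real M))"

definition x_model ::
  "real ^ 'nx ^ 'm \<Rightarrow> real ^ 'ny ^ 'm \<Rightarrow> real ^ 'm \<Rightarrow> real \<Rightarrow> real ^ 'nx \<Rightarrow> real ^ 'nx ^ 'nx \<Rightarrow>
   real ^ 'nx \<Rightarrow> real ^ 'ny \<Rightarrow> real ^ 'm \<Rightarrow> real ^ 'nx \<Rightarrow> real" where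
  "x_model A B b \<beta> v D x y lam z =
     v \<bullet> (z - x) + \<beta> / 2 * (norm (residual A B b z y - (1 / \<beta>) *\<^sub>R lam))\<^sup>2
       + \<beta> / 2 * sq_norm_wrt D (z - x)"

text \<open>A run of the unified inexact stochastic ADMM with batch size \<open>M\<close> on the probability space
  \<open>P\<close>. \<open>F k\<close> is the information available after \<open>k\<close> iterations; \<open>\<zeta> k i\<close> is the \<open>i\<close>-th sample
  drawn in iteration \<open>k\<close>. The iterates and the matrices are random; the matrices are chosen
  on the basis of \<open>F k\<close>. The quality of the approximate minimization in the \<open>x\<close>-step is controlled
  only by the two inexact criteria, which is why the tolerance in \<open>x_approx_min\<close> is arbitrary.
  The integrability assumptions state that the conditional expectations in the criteria exist.\<close>

locale unified_admm =
  prob_space P + filtration "space P" F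
  for f :: "real ^ 'nx \<Rightarrow> real" and g :: "real ^ 'ny \<Rightarrow> real"
    and A :: "real ^ 'nx ^ 'm" and B :: "real ^ 'ny ^ 'm" and b :: "real ^ 'm"
    and \<beta> s cx cx' cy \<sigma> :: real
    and G :: "real ^ 'nx \<Rightarrow> 's \<Rightarrow> real ^ 'nx" and \<Xi> :: "'s measure"
    and x0 :: "real ^ 'nx" and y0 :: "real ^ 'ny" and lam0 :: "real ^ 'm"
    and P :: "'p measure" and F :: "nat \<Rightarrow> 'p measure"
    and M :: nat and \<zeta> :: "nat \<Rightarrow> nat \<Rightarrow> 'p \<Rightarrow> 's"
    and x :: "nat \<Rightarrow> 'p \<Rightarrow> real ^ 'nx" and y :: "nat \<Rightarrow> 'p \<Rightarrow> real ^ 'ny"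
    and lam :: "nat \<Rightarrow> 'p \<Rightarrow> real ^ 'm"
    and Dx :: "nat \<Rightarrow> 'p \<Rightarrow> real ^ 'nx ^ 'nx" and Dy :: "nat \<Rightarrow> 'p \<Rightarrow> real ^ 'ny ^ 'ny" +
  assumes batch_size: "1 \<le> M"
    and subalg: "subalgebra P (F k)"
    and x_meas: "x k \<in> borel_measurable (F k)"
    and y_meas: "y k \<in> borel_measurable (F k)"
    and lam_meas: "lam k \<in> borel_measurable (F k)"
    and Dx_meas: "Dx k \<in> borel_measurable (F k)"
    and Dy_meas: "Dy k \<in> borel_measurable (F k)"
    and \<zeta>_meas: "i < M \<Longrightarrow> \<zeta> k i \<in> measurable (F (Suc k)) \<Xi>"
    and \<zeta>_distr: "i < M \<Longrightarrow> distr P \<Xi> (\<zeta> k i) = \<Xi>"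
    and \<zeta>_indep: "indep_vars (\<lambda>_. \<Xi>) (\<zeta> k) {..<M}"
    and \<zeta>_fresh:
      "indep_set (sets (F k))
         (sets (vimage_algebra (space P) (\<lambda>\<omega>. \<lambda>i\<in>{..<M}. \<zeta> k i \<omega>) (\<Pi>\<^sub>M i\<in>{..<M}. \<Xi>)))"
    and init: "\<omega> \<in> space P \<Longrightarrow> x 0 \<omega> = x0 \<and> y 0 \<omega> = y0 \<and> lam 0 \<omega> = lam0"
    and Dx_psd: "\<omega> \<in> space P \<Longrightarrow> sym_psd (Dx k \<omega>)"
    and Dx_bounded: "\<exists>c. \<forall>k. \<forall>\<omega>\<in>space P. onorm ((*v) (Dx k \<omega>)) \<le> c"
    and Dy_psd: "\<omega> \<in> space P \<Longrightarrow> sym_psd (Dy k \<omega>)"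
    and Dy_bounded: "\<omega> \<in> space P \<Longrightarrow> onorm ((*v) (Dy k \<omega>)) \<le> cy"
    and y_argmin:
      "\<omega> \<in> space P \<Longrightarrow>
         aug_lagrangian f g A B b \<beta> (x k \<omega>) (y (Suc k) \<omega>) (lam k \<omega>)
           + \<beta> / 2 * sq_norm_wrt (Dy k \<omega>) (y (Suc k) \<omega> - y k \<omega>)
         \<le> aug_lagrangian f g A B b \<beta> (x k \<omega>) z (lam k \<omega>)
           + \<beta> / 2 * sq_norm_wrt (Dy k \<omega>) (z - y k \<omega>)"
    and y_descent:
      "\<omega> \<in> space P \<Longrightarrow>
         \<beta> / 2 * sq_norm_wrt (Dy k \<omega>) (y (Suc k) \<omega> - y k \<omega>)
           + aug_lagrangian f g A B b \<beta> (x k \<omega>) (y (Suc k) \<omega>) (lam k \<omega>)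
         \<le> aug_lagrangian f g A B b \<beta> (x k \<omega>) (y k \<omega>) (lam k \<omega>)"
    and y_stationary:
      "\<omega> \<in> space P \<Longrightarrow>
         0 \<in> (\<lambda>v. v + \<beta> *\<^sub>R (transpose B *v (residual A B b (x k \<omega>) (y (Suc k) \<omega>)
                                                - (1 / \<beta>) *\<^sub>R lam k \<omega>))
                    + \<beta> *\<^sub>R (Dy k \<omega> *v (y (Suc k) \<omega> - y k \<omega>)))
             ` clarke_subdiff g (y (Suc k) \<omega>)"
    and x_approx_min:
      "\<omega> \<in> space P \<Longrightarrow>
         \<exists>\<epsilon>\<ge>0. \<forall>z.
           x_model A B b \<beta> (batch_grad G M (x k \<omega>) (\<lambda>i. \<zeta> k i \<omega>)) (Dx k \<omega>)
             (x k \<omega>) (y (Suc k) \<omega>) (lam k \<omega>) (x (Suc k) \<omega>)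
           \<le> x_model A B b \<beta> (batch_grad G M (x k \<omega>) (\<lambda>i. \<zeta> k i \<omega>)) (Dx k \<omega>)
               (x k \<omega>) (y (Suc k) \<omega>) (lam k \<omega>) z + \<epsilon>"
    and x_integrable:
      "integrable P (\<lambda>\<omega>. aug_lagrangian f g A B b \<beta> (x (Suc k) \<omega>) (y (Suc k) \<omega>) (lam k \<omega>))"
      "integrable P (\<lambda>\<omega>. sq_norm_wrt (Dx k \<omega>) (x (Suc k) \<omega> - x k \<omega>))"
      "integrable P (\<lambda>\<omega>. (norm (grad (\<lambda>z. aug_lagrangian f g A B b \<beta> z (y (Suc k) \<omega>) (lam k \<omega>))
                                   (x (Suc k) \<omega>)))\<^sup>2)"
      "integrable P (\<lambda>\<omega>. \<sigma>\<^sup>2 / real M + (norm (x k \<omega> - x (Suc k) \<omega>))\<^sup>2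
                           + (norm (y (Suc k) \<omega> - y k \<omega>))\<^sup>2)"
    and x_criterion_descent:
      "AE \<omega> in P.
         real_cond_exp P (F k)
           (\<lambda>\<omega>. aug_lagrangian f g A B b \<beta> (x (Suc k) \<omega>) (y (Suc k) \<omega>) (lam k \<omega>)) \<omega>
         \<le> aug_lagrangian f g A B b \<beta> (x k \<omega>) (y (Suc k) \<omega>) (lam k \<omega>)
           - \<beta> / 2 * real_cond_exp P (F k)
                       (\<lambda>\<omega>. sq_norm_wrt (Dx k \<omega>) (x (Suc k) \<omega> - x k \<omega>)) \<omega>
           + (cx' * \<beta>)\<^sup>2 / 2 * (\<sigma>\<^sup>2 / real M)"
    and x_criterion_gradient:
      "AE \<omega> in P.
         real_cond_exp P (F k)
           (\<lambda>\<omega>. (norm (grad (\<lambda>z. aug_lagrangian f g A B b \<beta> z (y (Suc k) \<omega>) (lam k \<omega>))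
                            (x (Suc k) \<omega>)))\<^sup>2) \<omega>
         \<le> (cx * \<beta>)\<^sup>2 * real_cond_exp P (F k)
               (\<lambda>\<omega>. \<sigma>\<^sup>2 / real M + (norm (x k \<omega> - x (Suc k) \<omega>))\<^sup>2
                       + (norm (y (Suc k) \<omega> - y k \<omega>))\<^sup>2) \<omega>"
    and lam_update:
      "\<omega> \<in> space P \<Longrightarrow>
         lam (Suc k) \<omega> = lam k \<omega> - (s * \<beta>) *\<^sub>R residual A B b (x (Suc k) \<omega>) (y (Suc k) \<omega>)"

end

theory Submission
  imports Defs
begin

text \<open>
  The proof bounds the expected sum of the squared increments of the iterates by a Lyapunov
  argument and then observes that these increments control the distance of \<open>0\<close> to the
  subdifferential of the augmented Lagrangian.

  Write \<open>\<Delta>\<^sub>k = \<lambda>\<^sub>k - \<lambda>\<^sub>k\<^sub>-\<^sub>1\<close> and let \<open>\<xi>\<^sub>k\<close> be the gradient error of the \<open>x\<close>-step. The \<open>x\<close>- and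
  \<open>y\<close>-steps decrease the augmented Lagrangian, but the multiplier step increases it by
  \<open>\<parallel>\<Delta>\<^sub>k\<parallel>\<^sup>2 / (s\<beta>)\<close>. Two facts control this increase. First, the range condition puts \<open>\<Delta>\<^sub>k\<close> into
  \<open>Range(A)\<close>, so that \<open>\<sigma>\<^sub>A \<parallel>\<Delta>\<^sub>k\<parallel>\<^sup>2 \<le> \<parallel>A\<^sup>T \<Delta>\<^sub>k\<parallel>\<^sup>2\<close> (\<open>norm_transpose_ge_on_range\<close>). Secondly, optimality of
  the \<open>x\<close>-step up to \<open>\<xi>\<close> turns the multiplier update into the relaxed recursion
  \<open>A\<^sup>T \<Delta>\<^sub>k\<^sub>+\<^sub>1 = (1 - s) A\<^sup>T \<Delta>\<^sub>k + s (\<nabla>f(x\<^sub>k\<^sub>+\<^sub>1) - \<nabla>f(x\<^sub>k) - \<xi>\<^sub>k\<^sub>+\<^sub>1 + \<xi>\<^sub>k)\<close> (\<open>lam_step_recursion\<close>). Since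
  \<open>0 < s < 2\<close>, convexity of the square bounds \<open>\<parallel>A\<^sup>T \<Delta>\<^sub>k\<^sub>+\<^sub>1\<parallel>\<^sup>2\<close> by a telescoping term and \<open>\<psi>\<^sub>1(s)\<close> times
  the squared forcing term (\<open>relaxed_step_norm_le\<close>); that term is of the order of the squared
  primal increments, up to the sampling noise \<open>\<sigma>\<^sup>2 / M\<close>. The hypotheses on the eigenvalues of the
  proximal matrices say that the primal decrease beats it
  with margin \<open>w\<close>. Hence the expected augmented
  Lagrangian, augmented by multiples of the expectations of \<open>\<parallel>A\<^sup>T \<Delta>\<^sub>k\<parallel>\<^sup>2\<close> and \<open>\<parallel>\<xi>\<^sub>k\<parallel>\<^sup>2\<close>, drops in every iteration by the
  expected squared increments, up to \<open>O(1/M)\<close> (\<open>potential_descent\<close>).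

  The recursion and the potential start at \<open>k = 0\<close>: putting \<open>\<Delta>\<^sub>0 = 0\<close> and
  \<open>\<xi>\<^sub>0 = \<nabla>f(x\<^sub>0) - A\<^sup>T \<lambda>\<^sub>0\<close> makes the first iteration obey the same law as all others, so the initial
  potential is an explicit constant. Summing over \<open>T \<le> \<kappa> M\<close> iterations keeps the accumulated noise
  bounded, and some iteration lies below the average, which is of order \<open>1 / T\<close>.
\<close>

section \<open>Smallest positive eigenvalue of a symmetric positive semidefinite matrix\<close>

lemma inner_transpose_matrix_vector:
  fixes D :: "real ^ 'n ^ 'm"
  shows "(transpose D *v a) \<bullet> b = a \<bullet> (D *v b)"
  by (metis dot_lmul_matrix transpose_matrix_vector)

text \<open>The least value \<open>\<mu>\<close> of the Rayleigh quotient on the range of \<open>D\<close> is attained, and its minimizer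
  is an eigenvector because the range is invariant under \<open>D\<close>. Every eigenvector for a positive
  eigenvalue lies in the range, so no positive eigenvalue is smaller than \<open>\<mu>\<close>. In particular
  the \<open>LEAST\<close> in the definition is attained.\<close>

lemma smallest_pos_eigenvalue_sym_psd:
  fixes D :: "real ^ 'n ^ 'n"
  assumes "sym_psd D" and "D \<noteq> 0"
  shows "0 < smallest_pos_eigenvalue D"
    and "v \<in> range ((*v) D) \<Longrightarrow> smallest_pos_eigenvalue D * (norm v)\<^sup>2 \<le> sq_norm_wrt D v"
proof -
  let ?R = "range ((*v) D)"
  let ?S = "sphere 0 1 \<inter> ?R"
  let ?q = "\<lambda>v. v \<bullet> (D *v v)"
  have sym: "(D *v a) \<bullet> b = a \<bullet> (D *v b)" for a b
    using inner_transpose_matrix_vector[of D a b] assms(1) by (metis sym_psd_def)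
  have psd: "0 \<le> ?q v" for v
    using assms(1) by (simp add: sym_psd_def)
  have sub: "subspace ?R"
    by (intro linear_subspace_image subspace_UNIV) (simp add: matrix_vector_mul_linear)
  have "\<exists>z. D *v z \<noteq> 0"
    using assms(2) by (metis matrix_eq matrix_vector_mult_0)
  then obtain z where z: "D *v z \<noteq> 0" ..
  have "(1 / norm (D *v z)) *\<^sub>R (D *v z) \<in> ?S"
    using z sub by (auto intro!: subspace_scale)
  then have "?S \<noteq> {}" by blast
  moreover have "compact ?S"
    using sub by (intro compact_Int_closed closed_subspace) auto
  moreover have "continuous_on ?S ?q"
    by (intro continuous_intros linear_continuous_on matrix_vector_mul_bounded_linear)
  ultimately obtain u where u: "u \<in> ?S" and u_min: "\<And>v. v \<in> ?S \<Longrightarrow> ?q u \<le> ?q v"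
    using continuous_attains_inf[of ?S ?q] by blast
  define \<mu> where "\<mu> = ?q u"
  have u_norm: "norm u = 1" and u_range: "u \<in> ?R" using u by auto
  have rayleigh: "\<mu> * (norm v)\<^sup>2 \<le> ?q v" if v: "v \<in> ?R" for v
  proof (cases "v = 0")
    case False
    have "(1 / norm v) *\<^sub>R v \<in> ?S"
      using False v sub by (auto intro!: subspace_scale)
    from u_min[OF this] have "\<mu> \<le> ?q v / (norm v)\<^sup>2"
      by (simp add: \<mu>_def matrix_vector_mult_scaleR power2_eq_square)
    then show ?thesis using False by (simp add: field_simps)
  qed simp
  \<comment> \<open>First-order optimality of \<open>u\<close> along the direction \<open>D u - \<mu> u\<close>, which stays in the range.\<close>
  have eig: "D *v u = \<mu> *\<^sub>R u"
  proof (rule ccontr)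
    assume ne: "D *v u \<noteq> \<mu> *\<^sub>R u"
    define h where "h = D *v u - \<mu> *\<^sub>R u"
    have h_range: "h \<in> ?R"
      unfolding h_def using sub u_range by (intro subspace_diff subspace_scale) auto
    have h_pos: "0 < h \<bullet> h" using ne by (simp add: h_def)
    define c where "c = ?q h - \<mu> * (h \<bullet> h)"
    have quad: "0 \<le> 2 * t * (h \<bullet> h) + t\<^sup>2 * c" for t
    proof -
      have "u + t *\<^sub>R h \<in> ?R" using sub u_range h_range by (intro subspace_add subspace_scale)
      from rayleigh[OF this]
      have "\<mu> * ((u + t *\<^sub>R h) \<bullet> (u + t *\<^sub>R h)) \<le> ?q (u + t *\<^sub>R h)"
        by (simp add: power2_norm_eq_inner)
      also have "?q (u + t *\<^sub>R h) = \<mu> + 2 * t * (h \<bullet> (D *v u)) + t\<^sup>2 * ?q h"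
        using sym[of u h]
        by (simp add: \<mu>_def matrix_vector_mult_scaleR matrix_vector_right_distrib inner_simps
            inner_commute power2_eq_square algebra_simps)
      also have "(u + t *\<^sub>R h) \<bullet> (u + t *\<^sub>R h) = 1 + 2 * t * (h \<bullet> u) + t\<^sup>2 * (h \<bullet> h)"
        using u_norm by (simp add: inner_simps inner_commute power2_eq_square algebra_simps
            norm_eq_1)
      finally have "0 \<le> 2 * t * (h \<bullet> (D *v u) - \<mu> * (h \<bullet> u)) + t\<^sup>2 * c"
        by (simp add: c_def algebra_simps)
      moreover have "h \<bullet> h = h \<bullet> (D *v u) - \<mu> * (h \<bullet> u)"
        by (subst (2) h_def) (simp add: inner_diff_right)
      ultimately show ?thesis by simp
    qed
    define t where "t = - (h \<bullet> h) / (\<bar>c\<bar> + 1)"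
    have "t\<^sup>2 * c \<le> t\<^sup>2 * (\<bar>c\<bar> + 1)" by (intro mult_left_mono) auto
    also have "\<dots> = - t * (h \<bullet> h)" by (simp add: t_def power2_eq_square)
    finally have "0 \<le> t * (h \<bullet> h)" using quad[of t] by simp
    moreover have "t < 0" using h_pos by (simp add: t_def divide_pos_pos)
    ultimately show False using h_pos by (simp add: zero_le_mult_iff)
  qed
  have \<mu>_pos: "0 < \<mu>"
  proof (rule ccontr)
    assume "\<not> 0 < \<mu>"
    then have "\<mu> = 0" using psd[of u] by (simp add: \<mu>_def)
    then have "D *v u = 0" using eig by simp
    moreover obtain z where "u = D *v z" using u_range by blast
    ultimately have "u \<bullet> u = 0" using sym[of u z] by simp
    then show False using u_norm by simp
  qed
  have "smallest_pos_eigenvalue D = \<mu>"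
    unfolding smallest_pos_eigenvalue_def
  proof (rule Least_equality)
    show "0 < \<mu> \<and> is_eigenvalue D \<mu>"
      unfolding is_eigenvalue_def using \<mu>_pos eig u_norm by (metis norm_zero zero_neq_one)
    fix e assume e: "0 < e \<and> is_eigenvalue D e"
    then obtain v where v: "v \<noteq> 0" "D *v v = e *\<^sub>R v" by (auto simp: is_eigenvalue_def)
    then have "v = D *v ((1 / e) *\<^sub>R v)" using e by (simp add: matrix_vector_mult_scaleR)
    then have "v \<in> ?R" by (metis rangeI)
    from rayleigh[OF this] show "\<mu> \<le> e"
      using v by (simp add: power2_norm_eq_inner)
  qed
  then show "0 < smallest_pos_eigenvalue D"
    and "v \<in> ?R \<Longrightarrow> smallest_pos_eigenvalue D * (norm v)\<^sup>2 \<le> sq_norm_wrt D v"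
    using \<mu>_pos rayleigh[of v] by (auto simp: sq_norm_wrt_def)
qed

lemma sq_norm_wrt_ge_invertible:
  fixes D :: "real ^ 'n ^ 'n"
  assumes "sym_psd D" and "invertible D"
  shows "smallest_pos_eigenvalue D * (norm v)\<^sup>2 \<le> sq_norm_wrt D v"
proof (rule smallest_pos_eigenvalue_sym_psd(2)[OF assms(1)])
  obtain E where "D ** E = mat 1" using assms(2) by (auto simp: invertible_def)
  then have DE: "D *v (E *v z) = z" for z
    by (simp add: matrix_vector_mul_assoc)
  then show "v \<in> range ((*v) D)" by (metis rangeI)
  show "D \<noteq> 0"
    using DE[of "axis undefined 1"] by auto
qed

lemma sym_psd_gram: "sym_psd (transpose A ** A)" for A :: "real ^ 'n ^ 'm"
proof -
  have "v \<bullet> ((transpose A ** A) *v v) = (norm (A *v v))\<^sup>2" for v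
    using inner_transpose_matrix_vector[of A "A *v v" v]
    by (simp add: matrix_vector_mul_assoc[symmetric] inner_commute power2_norm_eq_inner)
  then show ?thesis
    by (simp add: sym_psd_def matrix_transpose_mul transpose_transpose)
qed

lemma gram_nonzero:
  fixes A :: "real ^ 'n ^ 'm"
  assumes "A \<noteq> 0"
  shows "transpose A ** A \<noteq> 0"
proof
  assume "transpose A ** A = 0"
  then have "A *v v = 0" for v
    using inner_transpose_matrix_vector[of A "A *v v" v]
    by (simp add: matrix_vector_mul_assoc)
  then show False using assms by (metis matrix_eq matrix_vector_mult_0)
qed

text \<open>\<open>A A\<^sup>T\<close> and \<open>A\<^sup>T A\<close> have the same positive eigenvalues. Here this is obtained by writing \<open>z = A p\<close>
  with \<open>p\<close> in the range of \<open>A\<^sup>T A\<close>, where \<open>\<parallel>z\<parallel>\<^sup>2 \<ge> \<sigma> \<parallel>p\<parallel>\<^sup>2\<close>, and comparing with the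
  Cauchy--Schwarz bound \<open>\<parallel>z\<parallel>\<^sup>2 \<le> \<parallel>p\<parallel> \<parallel>A\<^sup>T z\<parallel>\<close>.\<close>

lemma norm_transpose_ge_on_range:
  fixes A :: "real ^ 'n ^ 'm"
  assumes "A \<noteq> 0" and "z \<in> range ((*v) A)"
  shows "smallest_pos_eigenvalue (transpose A ** A) * (norm z)\<^sup>2 \<le> (norm (transpose A *v z))\<^sup>2"
proof -
  let ?D = "transpose A ** A"
  let ?\<sigma> = "smallest_pos_eigenvalue ?D"
  let ?R = "range ((*v) ?D)"
  note psd = sym_psd_gram[of A]
  note nz = gram_nonzero[OF assms(1)]
  have D_app: "?D *v v = transpose A *v (A *v v)" for v
    by (simp add: matrix_vector_mul_assoc)
  have sq: "sq_norm_wrt ?D v = (norm (A *v v))\<^sup>2" for v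
    using inner_transpose_matrix_vector[of A "A *v v" v]
    by (simp add: sq_norm_wrt_def D_app inner_commute power2_norm_eq_inner)
  obtain p where p: "z = A *v p" using assms(2) by blast
  have sub: "subspace ?R"
    by (intro linear_subspace_image subspace_UNIV) (simp add: matrix_vector_mul_linear)
  \<comment> \<open>Only the part of \<open>p\<close> in the range of the Gram matrix matters:
    its orthogonal complement is the kernel of \<open>A\<close>.\<close>
  obtain p1 p2 where p1: "p1 \<in> ?R" and p2: "\<And>h. h \<in> ?R \<Longrightarrow> orthogonal p2 h" and "p = p1 + p2"
    using orthogonal_subspace_decomp_exists[of ?R p] sub by (metis span_eq_iff)
  have "sq_norm_wrt ?D p2 = 0"
    using p2[of "?D *v p2"] by (simp add: sq_norm_wrt_def orthogonal_def)
  then have "A *v p2 = 0" by (simp add: sq)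
  then have z1: "z = A *v p1" using p \<open>p = p1 + p2\<close> by (simp add: matrix_vector_right_distrib)
  have ray: "?\<sigma> * (norm p1)\<^sup>2 \<le> (norm z)\<^sup>2"
    using smallest_pos_eigenvalue_sym_psd(2)[OF psd nz p1] by (simp add: sq z1)
  have "(norm z)\<^sup>2 = p1 \<bullet> (transpose A *v z)"
    using inner_transpose_matrix_vector[of A z p1] by (simp add: z1 power2_norm_eq_inner inner_commute)
  then have cs: "(norm z)\<^sup>2 \<le> norm p1 * norm (transpose A *v z)"
    by (metis norm_cauchy_schwarz)
  show ?thesis
  proof (cases "z = 0")
    case False
    have "?\<sigma> * (norm z)\<^sup>2 * (norm z)\<^sup>2 \<le> ?\<sigma> * (norm p1 * norm (transpose A *v z))\<^sup>2"
      using power_mono[OF cs, of 2] smallest_pos_eigenvalue_sym_psd(1)[OF psd nz]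
      by (simp add: power2_eq_square mult.assoc)
    also have "\<dots> = ?\<sigma> * (norm p1)\<^sup>2 * (norm (transpose A *v z))\<^sup>2"
      by (simp add: power_mult_distrib)
    also have "\<dots> \<le> (norm z)\<^sup>2 * (norm (transpose A *v z))\<^sup>2"
      using ray by (intro mult_right_mono) auto
    finally show ?thesis using False by (simp add: mult.commute)
  qed simp
qed

section \<open>Gradients\<close>

lemma grad_eqI:
  assumes "GDERIV f x :> D"
  shows "grad f x = D"
  unfolding grad_def
proof (rule the_equality[where P = "\<lambda>D. GDERIV f x :> D", OF assms])
  fix E assume "GDERIV f x :> E"
  with assms have "(\<lambda>h. h \<bullet> E) = (\<lambda>h. h \<bullet> D)"
    unfolding gderiv_def by (rule has_derivative_unique[OF _ _, rotated])
  then have "(E - D) \<bullet> E = (E - D) \<bullet> D" by meson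
  then have "(E - D) \<bullet> (E - D) = 0" by (simp add: inner_diff_right)
  then show "E = D" by simp
qed

lemma gderiv_grad:
  fixes f :: "'a::euclidean_space \<Rightarrow> real"
  assumes "f differentiable (at x)"
  shows "GDERIV f x :> grad f x"
proof -
  obtain f' where f': "(f has_derivative f') (at x)"
    using assms by (auto simp: differentiable_def)
  then have lin: "linear f'" by (rule has_derivative_linear)
  have "f' = (\<lambda>h. h \<bullet> (\<Sum>i\<in>Basis. f' i *\<^sub>R i))"
  proof
    fix h
    have "f' h = f' (\<Sum>i\<in>Basis. (h \<bullet> i) *\<^sub>R i)" by (simp add: euclidean_representation)
    also have "\<dots> = (\<Sum>i\<in>Basis. (h \<bullet> i) * f' i)"
      by (simp add: linear_sum[OF lin] linear_cmul[OF lin])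
    also have "\<dots> = h \<bullet> (\<Sum>i\<in>Basis. f' i *\<^sub>R i)"
      by (simp add: inner_sum_right mult.commute)
    finally show "f' h = h \<bullet> (\<Sum>i\<in>Basis. f' i *\<^sub>R i)" .
  qed
  then have "GDERIV f x :> (\<Sum>i\<in>Basis. f' i *\<^sub>R i)"
    using f' by (simp add: gderiv_def)
  then show ?thesis using grad_eqI by metis
qed

lemma grad_aug_lagrangian:
  assumes "f differentiable (at x)"
  shows "grad (\<lambda>z. aug_lagrangian f g A B b \<beta> z y lam) x
    = grad f x - transpose A *v lam + \<beta> *\<^sub>R (transpose A *v residual A B b x y)"
proof (rule grad_eqI)
  have res: "((\<lambda>z. residual A B b z y) has_derivative (\<lambda>h. A *v h)) (at x)"
    unfolding residual_def
    by (auto intro!: derivative_eq_intros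
        bounded_linear_imp_has_derivative matrix_vector_mul_bounded_linear)
  have "(f has_derivative (\<lambda>h. h \<bullet> grad f x)) (at x)"
    using gderiv_grad[OF assms] by (simp add: gderiv_def)
  moreover have "h \<bullet> (u v* A) = (A *v h) \<bullet> u" for h u
    by (metis dot_lmul_matrix inner_commute)
  ultimately show "GDERIV (\<lambda>z. aug_lagrangian f g A B b \<beta> z y lam) x :>
      (grad f x - transpose A *v lam + \<beta> *\<^sub>R (transpose A *v residual A B b x y))"
    unfolding aug_lagrangian_def gderiv_def power2_norm_eq_inner
    by (auto intro!: derivative_eq_intros res
        simp: inner_diff_right inner_add_right inner_commute)
qed

section \<open>One step of the multiplier recursion\<close>

lemma norm_add_sq_le: "(norm (a + b))\<^sup>2 \<le> 2 * (norm a)\<^sup>2 + 2 * (norm b)\<^sup>2"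
  for a b :: "'a::real_normed_vector"
proof -
  have "(norm (a + b))\<^sup>2 \<le> (norm a + norm b)\<^sup>2"
    by (intro power_mono norm_triangle_ineq) auto
  also have "\<dots> \<le> 2 * (norm a)\<^sup>2 + 2 * (norm b)\<^sup>2"
    using sum_squares_bound[of "norm a" "norm b"] by (simp add: power2_sum)
  finally show ?thesis .
qed

lemma norm_diff_sq_le: "(norm (a - b))\<^sup>2 \<le> 2 * (norm a)\<^sup>2 + 2 * (norm b)\<^sup>2"
  for a b :: "'a::real_normed_vector"
  using norm_add_sq_le[of a "- b"] by simp

lemma psi1_eq:
  assumes "0 < s" "s < 2"
  shows "psi1 s = (s / (1 - \<bar>1 - s\<bar>))\<^sup>2"
proof (cases "s \<le> 1")
  case True
  then have "s\<^sup>2 \<le> (2 - s)\<^sup>2" using assms by (intro power_mono) auto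
  then show ?thesis using True assms by (simp add: psi1_def)
next
  case False
  then have "(2 - s)\<^sup>2 \<le> s\<^sup>2" using assms by (intro power_mono) auto
  then have "1 \<le> s\<^sup>2 / (2 - s)\<^sup>2" using assms by simp
  then show ?thesis using False by (simp add: psi1_def power_divide)
qed

text \<open>With \<open>\<theta> = 1 - \<bar>1 - s\<bar>\<close> the norm of \<open>p\<close> is at most the convex combination of \<open>\<parallel>a\<parallel>\<close> and
  \<open>(s / \<theta>) \<parallel>d\<parallel>\<close> with weights \<open>1 - \<theta>\<close> and \<open>\<theta>\<close>; the square is convex, and dividing by \<open>\<theta>\<close> produces a
  difference that telescopes along a recursion, plus \<open>(s / \<theta>)\<^sup>2 = psi1 s\<close> times \<open>\<parallel>d\<parallel>\<^sup>2\<close>.\<close>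

lemma relaxed_step_norm_le:
  fixes a d p :: "'a::real_normed_vector"
  assumes "0 < s" "s < 2" and p: "p = (1 - s) *\<^sub>R a + s *\<^sub>R d"
  shows "(norm p)\<^sup>2 \<le> \<bar>1 - s\<bar> / (1 - \<bar>1 - s\<bar>) * ((norm a)\<^sup>2 - (norm p)\<^sup>2) + psi1 s * (norm d)\<^sup>2"
proof -
  define \<theta> where "\<theta> = 1 - \<bar>1 - s\<bar>"
  have \<theta>: "0 < \<theta>" "\<theta> \<le> 1" using assms by (auto simp: \<theta>_def)
  define e where "e = s / \<theta> * norm d"
  have "norm p \<le> \<bar>1 - s\<bar> * norm a + s * norm d"
    unfolding p using assms by (intro norm_triangle_le) simp
  also have "\<dots> = (1 - \<theta>) * norm a + \<theta> * e"
    using \<theta> by (simp add: e_def) (simp add: \<theta>_def)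
  finally have "(norm p)\<^sup>2 \<le> ((1 - \<theta>) * norm a + \<theta> * e)\<^sup>2" by (intro power_mono) auto
  also have "\<dots> = (1 - \<theta>) * (norm a)\<^sup>2 + \<theta> * e\<^sup>2 - \<theta> * (1 - \<theta>) * (norm a - e)\<^sup>2"
    by (simp add: power2_eq_square algebra_simps)
  also have "\<dots> \<le> (1 - \<theta>) * (norm a)\<^sup>2 + \<theta> * e\<^sup>2" using \<theta> by simp
  finally have "(norm p)\<^sup>2 / \<theta> \<le> (1 - \<theta>) / \<theta> * (norm a)\<^sup>2 + e\<^sup>2"
    using \<theta> by (simp add: field_simps)
  moreover have "(norm p)\<^sup>2 / \<theta> = (norm p)\<^sup>2 + (1 - \<theta>) / \<theta> * (norm p)\<^sup>2"
    using \<theta> by (simp add: field_simps)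
  moreover have "e\<^sup>2 = psi1 s * (norm d)\<^sup>2"
    by (simp add: psi1_eq assms e_def \<theta>_def power_mult_distrib power_divide)
  moreover have "\<bar>1 - s\<bar> / (1 - \<bar>1 - s\<bar>) = (1 - \<theta>) / \<theta>" by (simp add: \<theta>_def)
  ultimately show ?thesis by (simp add: algebra_simps)
qed

section \<open>Runs with a dominating proximal term\<close>

text \<open>The price, in units of the augmented Lagrangian, of one unit of the squared forcing term in the
  multiplier recursion; the factor \<open>1 + \<tau>\<close> leaves a share \<open>\<tau>\<close> for controlling the multiplier
  increments themselves.\<close>

definition dual_weight :: "real ^ 'nx ^ 'm \<Rightarrow> real \<Rightarrow> real \<Rightarrow> real \<Rightarrow> real" where
  "dual_weight A \<beta> s \<tau> = (1 + \<tau>) / (s * \<beta> * smallest_pos_eigenvalue (transpose A ** A)) * psi1 s"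

text \<open>The last two assumptions are the eigenvalue conditions with the auxiliary constant substituted:
  half of the \<open>8 (cx \<beta>)\<^sup>2\<close> pays for the gradient error of the current iteration, the other half for
  the same error when it reappears in the next one.\<close>

locale prox_dominated_admm = unified_admm +
  fixes Lf w \<tau> Llow :: real
  assumes f_differentiable: "f differentiable (at z)"
    and grad_lipschitz: "Lf-lipschitz_on UNIV (grad f)"
    and range_subset: "range ((*v) B) \<union> {b} \<subseteq> range ((*v) A)"
    and A_nonzero: "A \<noteq> 0"
    and \<beta>_pos: "0 < \<beta>" and s_pos: "0 < s" and s_less_2: "s < 2"
    and w_pos: "0 < w" and \<tau>_pos: "0 < \<tau>"
    and bounded_below:
      "AE \<omega> in P. \<forall>k. Llow \<le> aug_lagrangian f g A B b \<beta> (x k \<omega>) (y k \<omega>) (lam k \<omega>)"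
    and Dx_invertible: "\<omega> \<in> space P \<Longrightarrow> invertible (Dx k \<omega>)"
    and Dy_invertible: "\<omega> \<in> space P \<Longrightarrow> invertible (Dy k \<omega>)"
    and Dx_dominates: "\<omega> \<in> space P \<Longrightarrow>
      dual_weight A \<beta> s \<tau> * (2 * Lf\<^sup>2 + 8 * (cx * \<beta>)\<^sup>2) + w
        \<le> \<beta> / 2 * smallest_pos_eigenvalue (Dx k \<omega>)"
    and Dy_dominates: "\<omega> \<in> space P \<Longrightarrow>
      8 * dual_weight A \<beta> s \<tau> * (cx * \<beta>)\<^sup>2 + w \<le> \<beta> / 2 * smallest_pos_eigenvalue (Dy k \<omega>)"
begin

abbreviation "\<sigma>A \<equiv> smallest_pos_eigenvalue (transpose A ** A)"
abbreviation "\<delta> \<equiv> dual_weight A \<beta> s \<tau>"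
abbreviation "AT v \<equiv> transpose A *v v"
abbreviation "lagr k \<omega> \<equiv> aug_lagrangian f g A B b \<beta> (x k \<omega>) (y k \<omega>) (lam k \<omega>)"
abbreviation "lagr_primal k \<omega> \<equiv>
  aug_lagrangian f g A B b \<beta> (x (Suc k) \<omega>) (y (Suc k) \<omega>) (lam k \<omega>)"

text \<open>At \<open>k = 0\<close> truncated subtraction makes all increments vanish. For \<open>k > 0\<close> the vector \<open>x_error k\<close> is
  the gradient of the augmented Lagrangian that the inexact criterion controls
  (\<open>x_error_Suc\<close>); expressed through multipliers it has a meaning at \<open>k = 0\<close> as well.\<close>

definition "x_step k \<omega> = x k \<omega> - x (k - 1) \<omega>"
definition "y_step k \<omega> = y k \<omega> - y (k - 1) \<omega>"
definition "lam_step k \<omega> = lam k \<omega> - lam (k - 1) \<omega>"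
definition "x_error k \<omega> = grad f (x k \<omega>) - AT (lam (k - 1) \<omega> + (1 / s) *\<^sub>R lam_step k \<omega>)"

subsection \<open>Pathwise estimates\<close>

lemma \<sigma>A_pos: "0 < \<sigma>A"
  by (rule smallest_pos_eigenvalue_sym_psd(1)[OF sym_psd_gram gram_nonzero[OF A_nonzero]])

lemma psi1_pos: "0 < psi1 s"
  by (simp add: psi1_def)

lemma dual_weight_nonneg: "0 \<le> \<delta>"
  using \<sigma>A_pos psi1_pos s_pos \<beta>_pos \<tau>_pos by (auto simp: dual_weight_def intro!: mult_nonneg_nonneg)

lemma lam_step_0 [simp]: "lam_step 0 \<omega> = 0"
  by (simp add: lam_step_def)

lemma lam_step_Suc:
  assumes "\<omega> \<in> space P"
  shows "lam_step (Suc k) \<omega> = - (s * \<beta>) *\<^sub>R residual A B b (x (Suc k) \<omega>) (y (Suc k) \<omega>)"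
  using lam_update[OF assms] by (simp add: lam_step_def)

lemma residual_eq_lam_step:
  assumes "\<omega> \<in> space P"
  shows "\<beta> *\<^sub>R residual A B b (x (Suc k) \<omega>) (y (Suc k) \<omega>) = - (1 / s) *\<^sub>R lam_step (Suc k) \<omega>"
  using s_pos by (simp add: lam_step_Suc[OF assms])

lemma x_error_0:
  assumes "\<omega> \<in> space P"
  shows "x_error 0 \<omega> = grad f x0 - AT lam0"
  using init[OF assms] by (simp add: x_error_def)

lemma x_error_Suc:
  assumes "\<omega> \<in> space P"
  shows "x_error (Suc k) \<omega>
    = grad (\<lambda>z. aug_lagrangian f g A B b \<beta> z (y (Suc k) \<omega>) (lam k \<omega>)) (x (Suc k) \<omega>)"
proof -
  have "\<beta> *\<^sub>R AT (residual A B b (x (Suc k) \<omega>) (y (Suc k) \<omega>)) = - AT ((1 / s) *\<^sub>R lam_step (Suc k) \<omega>)"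
    by (metis matrix_vector_mult_scaleR residual_eq_lam_step[OF assms] scaleR_minus_left)
  then show ?thesis
    by (simp only: grad_aug_lagrangian[OF f_differentiable] x_error_def diff_Suc_1
        matrix_vector_right_distrib) simp
qed

text \<open>By definition \<open>A\<^sup>T (\<lambda>\<^sub>k\<^sub>-\<^sub>1 + \<Delta>\<^sub>k / s) = \<nabla>f(x\<^sub>k) - \<xi>\<^sub>k\<close>; subtracting this for consecutive indices
  leaves only increments.\<close>

lemma lam_step_recursion:
  "AT (lam_step (Suc k) \<omega>) = (1 - s) *\<^sub>R AT (lam_step k \<omega>)
     + s *\<^sub>R ((grad f (x (Suc k) \<omega>) - grad f (x k \<omega>)) - (x_error (Suc k) \<omega> - x_error k \<omega>))"
proof -
  have "lam k \<omega> = lam (k - 1) \<omega> + lam_step k \<omega>" by (simp add: lam_step_def)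
  then have "(grad f (x (Suc k) \<omega>) - grad f (x k \<omega>)) - (x_error (Suc k) \<omega> - x_error k \<omega>)
    = AT (lam_step k \<omega>) + (1 / s) *\<^sub>R AT (lam_step (Suc k) \<omega>) - (1 / s) *\<^sub>R AT (lam_step k \<omega>)"
    by (simp only: x_error_def diff_Suc_1 matrix_vector_right_distrib matrix_vector_mult_scaleR) simp
  then show ?thesis
    using s_pos by (simp only: ) (simp add: algebra_simps)
qed

lemma lam_step_in_range:
  assumes "\<omega> \<in> space P"
  shows "lam_step k \<omega> \<in> range ((*v) A)"
proof (cases k)
  case 0
  then show ?thesis by (metis lam_step_0 matrix_vector_mult_0_right rangeI)
next
  case (Suc j)
  have "subspace (range ((*v) A))"
    by (intro linear_subspace_image subspace_UNIV) (simp add: matrix_vector_mul_linear)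
  moreover have "B *v v \<in> range ((*v) A)" "b \<in> range ((*v) A)" for v
    using range_subset by auto
  ultimately show ?thesis
    unfolding Suc lam_step_Suc[OF assms] residual_def
    by (intro subspace_scale subspace_diff subspace_add) auto
qed

lemma lam_step_norm_le:
  assumes "\<omega> \<in> space P"
  shows "\<sigma>A * (norm (lam_step k \<omega>))\<^sup>2 \<le> (norm (AT (lam_step k \<omega>)))\<^sup>2"
  by (rule norm_transpose_ge_on_range[OF A_nonzero lam_step_in_range[OF assms]])

text \<open>The coefficient of the telescoping term in \<open>relaxed_step_norm_le\<close>.\<close>

definition "\<gamma> = \<bar>1 - s\<bar> / (1 - \<bar>1 - s\<bar>)"

lemma \<gamma>_nonneg: "0 \<le> \<gamma>"
  using s_pos s_less_2 by (simp add: \<gamma>_def)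

lemma lam_step_bound:
  "(norm (AT (lam_step (Suc k) \<omega>)))\<^sup>2
     \<le> \<gamma> * ((norm (AT (lam_step k \<omega>)))\<^sup>2 - (norm (AT (lam_step (Suc k) \<omega>)))\<^sup>2)
       + psi1 s * (2 * Lf\<^sup>2 * (norm (x_step (Suc k) \<omega>))\<^sup>2
           + 4 * (norm (x_error (Suc k) \<omega>))\<^sup>2 + 4 * (norm (x_error k \<omega>))\<^sup>2)"
proof -
  let ?dg = "grad f (x (Suc k) \<omega>) - grad f (x k \<omega>)"
  let ?de = "x_error (Suc k) \<omega> - x_error k \<omega>"
  have "norm ?dg \<le> Lf * norm (x_step (Suc k) \<omega>)"
    using lipschitz_onD[OF grad_lipschitz UNIV_I UNIV_I] by (simp add: x_step_def dist_norm)
  then have "(norm ?dg)\<^sup>2 \<le> Lf\<^sup>2 * (norm (x_step (Suc k) \<omega>))\<^sup>2"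
    by (metis norm_ge_zero power_mono power_mult_distrib)
  then have "(norm (?dg - ?de))\<^sup>2 \<le> 2 * Lf\<^sup>2 * (norm (x_step (Suc k) \<omega>))\<^sup>2
           + 4 * (norm (x_error (Suc k) \<omega>))\<^sup>2 + 4 * (norm (x_error k \<omega>))\<^sup>2"
    using norm_diff_sq_le[of ?dg ?de] norm_diff_sq_le[of "x_error (Suc k) \<omega>" "x_error k \<omega>"]
    by linarith
  then have "psi1 s * (norm (?dg - ?de))\<^sup>2 \<le> psi1 s * (2 * Lf\<^sup>2 * (norm (x_step (Suc k) \<omega>))\<^sup>2
           + 4 * (norm (x_error (Suc k) \<omega>))\<^sup>2 + 4 * (norm (x_error k \<omega>))\<^sup>2)"
    using psi1_pos by (intro mult_left_mono) auto
  then show ?thesis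
    using relaxed_step_norm_le[OF s_pos s_less_2 lam_step_recursion[of k \<omega>]]
    unfolding \<gamma>_def by linarith
qed

lemma lagr_Suc:
  assumes "\<omega> \<in> space P"
  shows "lagr (Suc k) \<omega> = lagr_primal k \<omega> + 1 / (s * \<beta>) * (norm (lam_step (Suc k) \<omega>))\<^sup>2"
proof -
  have "lagr (Suc k) \<omega> - lagr_primal k \<omega>
    = - (lam_step (Suc k) \<omega> \<bullet> residual A B b (x (Suc k) \<omega>) (y (Suc k) \<omega>))"
    by (simp add: aug_lagrangian_def lam_step_def inner_diff_left)
  also have "\<dots> = 1 / (s * \<beta>) * (norm (lam_step (Suc k) \<omega>))\<^sup>2"
    using s_pos \<beta>_pos by (simp add: lam_step_Suc[OF assms] power2_norm_eq_inner[symmetric]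
        power2_eq_square)
  finally show ?thesis by simp
qed

end

section \<open>Stationarity, integrability and descent\<close>

text \<open>The squared operator norms that appear when the components of the subgradient in
  \<open>subdiff_element\<close> are estimated by the increments and the gradient error.\<close>

definition stationarity_factor ::
  "real ^ 'nx ^ 'm \<Rightarrow> real ^ 'ny ^ 'm \<Rightarrow> real \<Rightarrow> real \<Rightarrow> real \<Rightarrow> real" where
  "stationarity_factor A B \<beta> s cy =
     2 + 2 * (onorm ((*v) (transpose A)))\<^sup>2
       + 4 * (onorm ((*v) (transpose B)))\<^sup>2 + (1 / (s * \<beta>))\<^sup>2
       + 2 * (\<beta> * (onorm ((*v) (transpose B)) * onorm ((*v) A)))\<^sup>2 + 4 * (\<beta> * cy)\<^sup>2"

lemma stationarity_factor_nonneg: "0 \<le> stationarity_factor A B \<beta> s cy"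
  by (simp add: stationarity_factor_def)

lemma norm_matrix_vector_sq_le:
  fixes D :: "real ^ 'n ^ 'm"
  assumes "onorm ((*v) D) \<le> c"
  shows "(norm (D *v v))\<^sup>2 \<le> c\<^sup>2 * (norm v)\<^sup>2"
proof -
  have "norm (D *v v) \<le> onorm ((*v) D) * norm v"
    by (rule onorm[OF matrix_vector_mul_bounded_linear])
  also have "\<dots> \<le> c * norm v" using assms by (intro mult_right_mono) auto
  finally show ?thesis by (metis norm_ge_zero power_mono power_mult_distrib)
qed

lemma sum_le_of_descent:
  fixes \<Phi> r :: "nat \<Rightarrow> real"
  assumes "\<And>k. \<Phi> (Suc k) + r (Suc k) \<le> \<Phi> k + e"
  shows "\<Phi> T + (\<Sum>k=1..T. r k) \<le> \<Phi> 0 + real T * e"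
proof (induction T)
  case (Suc T)
  then show ?case using assms[of T] by (simp add: algebra_simps)
qed simp

context prox_dominated_admm
begin

subsection \<open>Distance of zero to the subdifferential\<close>

definition "step_errors k \<omega> = (norm (x_error k \<omega>))\<^sup>2 + (norm (x_step k \<omega>))\<^sup>2
  + (norm (y_step k \<omega>))\<^sup>2 + (norm (lam_step k \<omega>))\<^sup>2"

text \<open>The multiplier update expresses \<open>\<beta> r\<close> through \<open>\<Delta>\<close>, and the stationarity of the \<open>y\<close>-step supplies a
  Clarke subgradient. That subgradient refers to the old \<open>x\<close> and the old multiplier, which is where
  the increments of both enter.\<close>

lemma subdiff_element:
  assumes "\<omega> \<in> space P"
  shows "(x_error (Suc k) \<omega> - AT (lam_step (Suc k) \<omega>),
      \<beta> *\<^sub>R (transpose B *v (A *v x_step (Suc k) \<omega>)) - transpose B *v lam_step (Suc k) \<omega>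
        - \<beta> *\<^sub>R (Dy k \<omega> *v y_step (Suc k) \<omega>),
      (1 / (s * \<beta>)) *\<^sub>R lam_step (Suc k) \<omega>)
    \<in> subdiff_aug_lagrangian f g A B b \<beta> (x (Suc k) \<omega>) (y (Suc k) \<omega>) (lam (Suc k) \<omega>)"
    (is "(?p, ?q, ?t) \<in> _")
proof -
  let ?r = "residual A B b (x (Suc k) \<omega>) (y (Suc k) \<omega>)"
  let ?d = "lam_step (Suc k) \<omega>"
  have lam: "lam (Suc k) \<omega> = lam k \<omega> + ?d" by (simp add: lam_step_def)
  have res: "\<beta> *\<^sub>R (E *v ?r) = - (1 / s) *\<^sub>R (E *v ?d)" for E :: "real ^ _ ^ 'row"
    by (metis matrix_vector_mult_scaleR residual_eq_lam_step[OF assms])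
  have p: "?p = grad f (x (Suc k) \<omega>) - AT (lam (Suc k) \<omega>) + \<beta> *\<^sub>R AT ?r"
    unfolding res x_error_def lam
    by (simp only: diff_Suc_1 matrix_vector_right_distrib matrix_vector_mult_scaleR) simp
  obtain v where v: "v \<in> clarke_subdiff g (y (Suc k) \<omega>)"
    and v0: "0 = v + \<beta> *\<^sub>R (transpose B *v (residual A B b (x k \<omega>) (y (Suc k) \<omega>)
        - (1 / \<beta>) *\<^sub>R lam k \<omega>)) + \<beta> *\<^sub>R (Dy k \<omega> *v (y (Suc k) \<omega> - y k \<omega>))"
    using y_stationary[OF assms, of k] by blast
  have shift: "residual A B b (x k \<omega>) (y (Suc k) \<omega>) = ?r - A *v x_step (Suc k) \<omega>"
    by (simp add: residual_def x_step_def matrix_vector_mult_diff_distrib)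
  have "v = - (\<beta> *\<^sub>R (transpose B *v (?r - A *v x_step (Suc k) \<omega> - (1 / \<beta>) *\<^sub>R lam k \<omega>)))
      - \<beta> *\<^sub>R (Dy k \<omega> *v y_step (Suc k) \<omega>)"
    using v0 unfolding shift y_step_def diff_Suc_1
    by (metis (no_types, lifting) add.assoc add_uminus_conv_diff eq_neg_iff_add_eq_0 minus_add_distrib)
  also have "\<dots> = - \<beta> *\<^sub>R (transpose B *v ?r) + \<beta> *\<^sub>R (transpose B *v (A *v x_step (Suc k) \<omega>))
      + transpose B *v lam k \<omega> - \<beta> *\<^sub>R (Dy k \<omega> *v y_step (Suc k) \<omega>)"
    using \<beta>_pos by (simp only: matrix_vector_mult_diff_distrib matrix_vector_mult_scaleR)
      (simp add: scaleR_diff_right)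
  finally have q: "?q = v - transpose B *v lam (Suc k) \<omega> + \<beta> *\<^sub>R (transpose B *v ?r)"
    unfolding lam by (simp only: matrix_vector_right_distrib) simp
  have t: "?t = - ?r"
    using s_pos \<beta>_pos by (simp add: lam_step_Suc[OF assms])
  show ?thesis
    unfolding subdiff_aug_lagrangian_def Let_def
    using v by (intro SigmaI) (simp_all only: p q t singleton_iff image_eqI)
qed

lemma infdist_le_step_errors:
  assumes "\<omega> \<in> space P"
  shows "(infdist 0 (subdiff_aug_lagrangian f g A B b \<beta> (x (Suc k) \<omega>) (y (Suc k) \<omega>) (lam (Suc k) \<omega>)))\<^sup>2
    \<le> stationarity_factor A B \<beta> s cy * step_errors (Suc k) \<omega>"
proof -
  let ?d = "lam_step (Suc k) \<omega>"
  let ?bAx = "transpose B *v (A *v x_step (Suc k) \<omega>)"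
  let ?bd = "transpose B *v ?d"
  let ?Dy = "Dy k \<omega> *v y_step (Suc k) \<omega>"
  define nA nA' nB where "nA = onorm ((*v) A)" and "nA' = onorm ((*v) (transpose A))"
    and "nB = onorm ((*v) (transpose B))"
  define Z X Y D where "Z = (norm (x_error (Suc k) \<omega>))\<^sup>2" and "X = (norm (x_step (Suc k) \<omega>))\<^sup>2"
    and "Y = (norm (y_step (Suc k) \<omega>))\<^sup>2" and "D = (norm ?d)\<^sup>2"
  note defs = Z_def X_def Y_def D_def
  have nonneg: "0 \<le> Z" "0 \<le> X" "0 \<le> Y" "0 \<le> D" by (simp_all add: defs)
  let ?p = "x_error (Suc k) \<omega> - AT ?d"
  let ?q = "\<beta> *\<^sub>R ?bAx - ?bd - \<beta> *\<^sub>R ?Dy"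
  let ?t = "(1 / (s * \<beta>)) *\<^sub>R ?d"
  have "infdist 0 (subdiff_aug_lagrangian f g A B b \<beta> (x (Suc k) \<omega>) (y (Suc k) \<omega>) (lam (Suc k) \<omega>))
    \<le> norm (?p, ?q, ?t)"
    using infdist_le[OF subdiff_element[OF assms], of 0] by (simp only: dist_0_norm)
  then have "(infdist 0 (subdiff_aug_lagrangian f g A B b \<beta> (x (Suc k) \<omega>) (y (Suc k) \<omega>) (lam (Suc k) \<omega>)))\<^sup>2
    \<le> (norm (?p, ?q, ?t))\<^sup>2"
    by (intro power_mono infdist_nonneg)
  also have "\<dots> = (norm ?p)\<^sup>2 + (norm ?q)\<^sup>2 + (norm ?t)\<^sup>2"
    by (simp add: norm_Pair)
  finally have dist: "(infdist 0 (subdiff_aug_lagrangian f g A B b \<beta> (x (Suc k) \<omega>) (y (Suc k) \<omega>) (lam (Suc k) \<omega>)))\<^sup>2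
    \<le> (norm ?p)\<^sup>2 + (norm ?q)\<^sup>2 + (norm ?t)\<^sup>2" .
  have p: "(norm ?p)\<^sup>2 \<le> 2 * Z + 2 * (nA'\<^sup>2 * D)"
    using norm_diff_sq_le[of "x_error (Suc k) \<omega>" "AT ?d"]
      norm_matrix_vector_sq_le[OF order_refl, of "transpose A" ?d]
    unfolding defs nA'_def by linarith
  have q: "(norm ?q)\<^sup>2 \<le> 2 * ((\<beta> * (nB * nA))\<^sup>2 * X) + 4 * (nB\<^sup>2 * D) + 4 * ((\<beta> * cy)\<^sup>2 * Y)"
  proof -
    have "(norm ?bAx)\<^sup>2 \<le> nB\<^sup>2 * (norm (A *v x_step (Suc k) \<omega>))\<^sup>2"
      unfolding nB_def by (rule norm_matrix_vector_sq_le[OF order_refl])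
    also have "\<dots> \<le> nB\<^sup>2 * (nA\<^sup>2 * X)"
      unfolding nA_def defs by (intro mult_left_mono norm_matrix_vector_sq_le order_refl) simp
    finally have "\<beta>\<^sup>2 * (norm ?bAx)\<^sup>2 \<le> \<beta>\<^sup>2 * (nB\<^sup>2 * (nA\<^sup>2 * X))" by (intro mult_left_mono) auto
    then have 1: "(norm (\<beta> *\<^sub>R ?bAx))\<^sup>2 \<le> (\<beta> * (nB * nA))\<^sup>2 * X"
      by (simp add: power_mult_distrib mult.assoc)
    have 2: "(norm ?bd)\<^sup>2 \<le> nB\<^sup>2 * D"
      unfolding nB_def D_def by (rule norm_matrix_vector_sq_le[OF order_refl])
    have "(norm ?Dy)\<^sup>2 \<le> cy\<^sup>2 * Y"
      unfolding defs by (rule norm_matrix_vector_sq_le[OF Dy_bounded[OF assms]])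
    then have "\<beta>\<^sup>2 * (norm ?Dy)\<^sup>2 \<le> \<beta>\<^sup>2 * (cy\<^sup>2 * Y)" by (intro mult_left_mono) auto
    then have 3: "(norm (\<beta> *\<^sub>R ?Dy))\<^sup>2 \<le> (\<beta> * cy)\<^sup>2 * Y"
      by (simp add: power_mult_distrib mult.assoc)
    show ?thesis
      using 1 2 3 norm_diff_sq_le[of "\<beta> *\<^sub>R ?bAx" "?bd + \<beta> *\<^sub>R ?Dy"] norm_add_sq_le[of ?bd "\<beta> *\<^sub>R ?Dy"]
      by (simp only: diff_diff_eq)
  qed
  have t: "(norm ?t)\<^sup>2 = (1 / (s * \<beta>))\<^sup>2 * D"
    by (simp add: D_def power_mult_distrib power_divide)
  let ?K = "2 + 2 * nA'\<^sup>2 + 4 * nB\<^sup>2 + (1 / (s * \<beta>))\<^sup>2 + 2 * (\<beta> * (nB * nA))\<^sup>2 + 4 * (\<beta> * cy)\<^sup>2"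
  have "2 * Z \<le> ?K * Z" "2 * (\<beta> * (nB * nA))\<^sup>2 * X \<le> ?K * X" "4 * (\<beta> * cy)\<^sup>2 * Y \<le> ?K * Y"
    "(2 * nA'\<^sup>2 + 4 * nB\<^sup>2 + (1 / (s * \<beta>))\<^sup>2) * D \<le> ?K * D"
    using nonneg by (auto intro!: mult_right_mono)
  then have "(norm ?p)\<^sup>2 + (norm ?q)\<^sup>2 + (norm ?t)\<^sup>2 \<le> ?K * Z + ?K * X + ?K * Y + ?K * D"
    using p q t unfolding distrib_right[of _ _ D] mult.assoc by linarith
  also have "\<dots> = stationarity_factor A B \<beta> s cy * step_errors (Suc k) \<omega>"
    by (simp only: stationarity_factor_def step_errors_def defs nA_def nA'_def nB_def distrib_left)
  finally show ?thesis using dist by linarith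
qed

subsection \<open>Integrability\<close>

lemma sigma_finite_subalgebra_F: "sigma_finite_subalgebra P (F k)"
  by (intro finite_measure_subalgebra_is_sigma_finite finite_measure_subalgebra.intro
      finite_measure_subalgebra_axioms.intro subalg finite_measure_axioms)

lemma measurable_iterates [measurable]:
  "x k \<in> borel_measurable P" "y k \<in> borel_measurable P" "lam k \<in> borel_measurable P"
  using measurable_from_subalg[OF subalg] x_meas y_meas lam_meas by blast+

lemma measurable_steps [measurable]:
  "x_step k \<in> borel_measurable P" "y_step k \<in> borel_measurable P" "lam_step k \<in> borel_measurable P"
  unfolding x_step_def y_step_def lam_step_def by measurable

lemma measurable_matrix_vector [measurable]:
  fixes D :: "real ^ 'col ^ 'row"
  assumes "h \<in> borel_measurable P"
  shows "(\<lambda>\<omega>. D *v h \<omega>) \<in> borel_measurable P"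
  using assms by (rule borel_measurable_continuous_on[rotated])
    (intro linear_continuous_on matrix_vector_mul_bounded_linear)

lemma integrable_primal_steps:
  "integrable P (\<lambda>\<omega>. (norm (x_step (Suc k) \<omega>))\<^sup>2)"
  "integrable P (\<lambda>\<omega>. (norm (y_step (Suc k) \<omega>))\<^sup>2)"
  by (rule Bochner_Integration.integrable_bound[OF x_integrable(4)[of k]];
      simp add: x_step_def y_step_def norm_minus_commute add_nonneg_nonneg; fail)+

lemma integrable_x_error: "integrable P (\<lambda>\<omega>. (norm (x_error k \<omega>))\<^sup>2)"
proof (cases k)
  case 0
  have "integrable P (\<lambda>\<omega>. (norm (grad f x0 - AT lam0))\<^sup>2)" by simp
  then show ?thesis unfolding 0
    by (rule Bochner_Integration.integrable_cong[THEN iffD1, OF refl, rotated]) (simp add: x_error_0)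
next
  case (Suc j)
  show ?thesis unfolding Suc
    by (rule Bochner_Integration.integrable_cong[THEN iffD1, OF refl _ x_integrable(3)[of j]])
      (simp add: x_error_Suc)
qed

text \<open>Integrability propagates through the recursion, starting from \<open>\<Delta>\<^sub>0 = 0\<close> and driven by the
  integrability of the primal increments and gradient errors.\<close>

lemma integrable_transpose_lam_step: "integrable P (\<lambda>\<omega>. (norm (AT (lam_step k \<omega>)))\<^sup>2)"
proof (induction k)
  case (Suc k)
  let ?bound = "\<lambda>\<omega>. \<gamma> * (norm (AT (lam_step k \<omega>)))\<^sup>2
    + psi1 s * (2 * Lf\<^sup>2 * (norm (x_step (Suc k) \<omega>))\<^sup>2
           + 4 * (norm (x_error (Suc k) \<omega>))\<^sup>2 + 4 * (norm (x_error k \<omega>))\<^sup>2)"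
  have "(norm (AT (lam_step (Suc k) \<omega>)))\<^sup>2 \<le> ?bound \<omega>" for \<omega>
  proof -
    have "0 \<le> \<gamma> * (norm (AT (lam_step (Suc k) \<omega>)))\<^sup>2" using \<gamma>_nonneg by simp
    then show ?thesis using lam_step_bound[of k \<omega>] unfolding right_diff_distrib by linarith
  qed
  moreover have "integrable P ?bound"
    by (intro Bochner_Integration.integrable_add integrable_mult_right Suc
        integrable_primal_steps integrable_x_error)
  ultimately show ?case
    by (elim Bochner_Integration.integrable_bound) (auto simp del: transpose_matrix_vector intro!: AE_I2 order_trans[OF _ abs_ge_self])
qed (simp del: transpose_matrix_vector)

lemma integrable_lam_step: "integrable P (\<lambda>\<omega>. (norm (lam_step k \<omega>))\<^sup>2)"
proof (rule Bochner_Integration.integrable_bound)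
  show "integrable P (\<lambda>\<omega>. (1 / \<sigma>A) * (norm (AT (lam_step k \<omega>)))\<^sup>2)"
    by (intro integrable_mult_right integrable_transpose_lam_step)
  show "AE \<omega> in P. norm ((norm (lam_step k \<omega>))\<^sup>2) \<le> norm ((1 / \<sigma>A) * (norm (AT (lam_step k \<omega>)))\<^sup>2)"
    using lam_step_norm_le \<sigma>A_pos
    by (intro AE_I2) (simp add: field_simps del: transpose_matrix_vector)
qed measurable

lemma integrable_lagr: "integrable P (lagr k)"
proof (cases k)
  case 0
  have "integrable P (\<lambda>\<omega>. aug_lagrangian f g A B b \<beta> x0 y0 lam0)" by simp
  then show ?thesis unfolding 0
    by (rule Bochner_Integration.integrable_cong[THEN iffD1, OF refl, rotated]) (simp add: init)
next
  case (Suc j)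
  have "integrable P (\<lambda>\<omega>. lagr_primal j \<omega> + 1 / (s * \<beta>) * (norm (lam_step (Suc j) \<omega>))\<^sup>2)"
    by (intro Bochner_Integration.integrable_add integrable_mult_right x_integrable(1) integrable_lam_step)
  then show ?thesis unfolding Suc
    by (rule Bochner_Integration.integrable_cong[THEN iffD1, OF refl, rotated]) (simp add: lagr_Suc)
qed

lemma integrable_step_errors: "integrable P (step_errors (Suc k))"
  unfolding step_errors_def[abs_def]
  by (intro Bochner_Integration.integrable_add integrable_x_error integrable_primal_steps
      integrable_lam_step)

subsection \<open>Descent in expectation\<close>

lemma expectation_x_error_le:
  "expectation (\<lambda>\<omega>. (norm (x_error (Suc k) \<omega>))\<^sup>2)
    \<le> (cx * \<beta>)\<^sup>2 * (\<sigma>\<^sup>2 / real M + expectation (\<lambda>\<omega>. (norm (x_step (Suc k) \<omega>))\<^sup>2)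
        + expectation (\<lambda>\<omega>. (norm (y_step (Suc k) \<omega>))\<^sup>2))"
proof -
  interpret sigma_finite_subalgebra P "F k" by (rule sigma_finite_subalgebra_F)
  let ?xi = "\<lambda>\<omega>. (norm (grad (\<lambda>z. aug_lagrangian f g A B b \<beta> z (y (Suc k) \<omega>) (lam k \<omega>)) (x (Suc k) \<omega>)))\<^sup>2"
  let ?st = "\<lambda>\<omega>. \<sigma>\<^sup>2 / real M + (norm (x k \<omega> - x (Suc k) \<omega>))\<^sup>2 + (norm (y (Suc k) \<omega> - y k \<omega>))\<^sup>2"
  have "expectation (\<lambda>\<omega>. (norm (x_error (Suc k) \<omega>))\<^sup>2) = expectation ?xi"
    by (rule Bochner_Integration.integral_cong[OF refl]) (simp add: x_error_Suc)
  also have "\<dots> = expectation (real_cond_exp P (F k) ?xi)"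
    by (rule real_cond_exp_int(2)[OF x_integrable(3), symmetric])
  also have "\<dots> \<le> expectation (\<lambda>\<omega>. (cx * \<beta>)\<^sup>2 * real_cond_exp P (F k) ?st \<omega>)"
    by (intro integral_mono_AE real_cond_exp_int(1) integrable_mult_right x_integrable
        x_criterion_gradient)
  also have "\<dots> = (cx * \<beta>)\<^sup>2 * expectation ?st"
    by (simp add: real_cond_exp_int(2)[OF x_integrable(4)])
  also have "expectation ?st = expectation (\<lambda>\<omega>. \<sigma>\<^sup>2 / real M + (norm (x_step (Suc k) \<omega>))\<^sup>2
      + (norm (y_step (Suc k) \<omega>))\<^sup>2)"
    by (simp add: x_step_def y_step_def norm_minus_commute)
  also have "\<dots> = \<sigma>\<^sup>2 / real M + expectation (\<lambda>\<omega>. (norm (x_step (Suc k) \<omega>))\<^sup>2)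
        + expectation (\<lambda>\<omega>. (norm (y_step (Suc k) \<omega>))\<^sup>2)"
    by (simp add: integrable_primal_steps prob_space)
  finally show ?thesis .
qed

text \<open>The \<open>x\<close>-criterion bounds a conditional expectation by the augmented Lagrangian after the
  \<open>y\<close>-step, whose integrability is unclear. Combining it pathwise with the descent of the \<open>y\<close>-step
  replaces that value by the integrable one at the start of the iteration before integrating.\<close>

lemma expectation_lagr_descent:
  "expectation (lagr (Suc k))
     + (\<delta> * (2 * Lf\<^sup>2 + 8 * (cx * \<beta>)\<^sup>2) + w) * expectation (\<lambda>\<omega>. (norm (x_step (Suc k) \<omega>))\<^sup>2)
     + (8 * \<delta> * (cx * \<beta>)\<^sup>2 + w) * expectation (\<lambda>\<omega>. (norm (y_step (Suc k) \<omega>))\<^sup>2)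
   \<le> expectation (lagr k) + 1 / (s * \<beta>) * expectation (\<lambda>\<omega>. (norm (lam_step (Suc k) \<omega>))\<^sup>2)
     + (cx' * \<beta>)\<^sup>2 / 2 * (\<sigma>\<^sup>2 / real M)"
    (is "_ + ?cX * ?EX + ?cY * ?EY \<le> _ + ?cD * ?ED + ?e")
proof -
  interpret sigma_finite_subalgebra P "F k" by (rule sigma_finite_subalgebra_F)
  let ?sqx = "\<lambda>\<omega>. sq_norm_wrt (Dx k \<omega>) (x (Suc k) \<omega> - x k \<omega>)"
  let ?Y = "\<lambda>\<omega>. (norm (y_step (Suc k) \<omega>))\<^sup>2"
  have weighted: "c * (norm v)\<^sup>2 \<le> \<beta> / 2 * sq_norm_wrt D v"
    if "sym_psd D" "invertible D" "c \<le> \<beta> / 2 * smallest_pos_eigenvalue D"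
    for c and D :: "real ^ 'row ^ 'row" and v
  proof -
    have "c * (norm v)\<^sup>2 \<le> \<beta> / 2 * smallest_pos_eigenvalue D * (norm v)\<^sup>2"
      using that(3) by (intro mult_right_mono) auto
    also have "\<dots> \<le> \<beta> / 2 * sq_norm_wrt D v"
      using sq_norm_wrt_ge_invertible[OF that(1,2), of v] \<beta>_pos by simp
    finally show ?thesis .
  qed
  have int_rhs: "integrable P (\<lambda>\<omega>. lagr k \<omega> - ?cY * ?Y \<omega> + ?e)"
    by (intro Bochner_Integration.integrable_add Bochner_Integration.integrable_diff
        integrable_mult_right integrable_lagr integrable_primal_steps) simp
  have "AE \<omega> in P. real_cond_exp P (F k) (lagr_primal k) \<omega> + \<beta> / 2 * real_cond_exp P (F k) ?sqx \<omega>
     \<le> lagr k \<omega> - ?cY * ?Y \<omega> + ?e"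
    using x_criterion_descent[of k] AE_space
  proof eventually_elim
    case (elim \<omega>)
    have "?cY * ?Y \<omega> \<le> \<beta> / 2 * sq_norm_wrt (Dy k \<omega>) (y (Suc k) \<omega> - y k \<omega>)"
      unfolding y_step_def diff_Suc_1
      by (rule weighted[OF Dy_psd Dy_invertible Dy_dominates]) (use elim in auto)
    then show ?case using elim(1) y_descent[OF elim(2), of k] by linarith
  qed
  then have "expectation (\<lambda>\<omega>. real_cond_exp P (F k) (lagr_primal k) \<omega>
        + \<beta> / 2 * real_cond_exp P (F k) ?sqx \<omega>)
      \<le> expectation (\<lambda>\<omega>. lagr k \<omega> - ?cY * ?Y \<omega> + ?e)"
    by (intro integral_mono_AE int_rhs Bochner_Integration.integrable_add integrable_mult_right
        real_cond_exp_int(1) x_integrable)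
  also have "\<dots> = expectation (lagr k) - ?cY * ?EY + ?e"
    by (simp add: integrable_lagr integrable_primal_steps prob_space)
  also have "expectation (\<lambda>\<omega>. real_cond_exp P (F k) (lagr_primal k) \<omega>
        + \<beta> / 2 * real_cond_exp P (F k) ?sqx \<omega>)
      = expectation (lagr_primal k) + \<beta> / 2 * expectation ?sqx"
    by (simp add: real_cond_exp_int x_integrable)
  finally have main: "expectation (lagr_primal k) + \<beta> / 2 * expectation ?sqx
      \<le> expectation (lagr k) - ?cY * ?EY + ?e" .
  have "?cX * ?EX = expectation (\<lambda>\<omega>. ?cX * (norm (x_step (Suc k) \<omega>))\<^sup>2)" by simp
  also have "\<dots> \<le> expectation (\<lambda>\<omega>. \<beta> / 2 * ?sqx \<omega>)"
    by (intro integral_mono integrable_mult_right integrable_primal_steps x_integrable)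
      (simp only: x_step_def diff_Suc_1 weighted[OF Dx_psd Dx_invertible Dx_dominates])
  finally have X: "?cX * ?EX \<le> \<beta> / 2 * expectation ?sqx" by simp
  have "expectation (lagr (Suc k))
    = expectation (\<lambda>\<omega>. lagr_primal k \<omega> + ?cD * (norm (lam_step (Suc k) \<omega>))\<^sup>2)"
    by (rule Bochner_Integration.integral_cong[OF refl lagr_Suc])
  also have "\<dots> = expectation (lagr_primal k) + ?cD * ?ED"
    by (simp add: x_integrable integrable_lam_step)
  finally show ?thesis using main X by linarith
qed

lemma expectation_lam_step_le:
  "(1 + \<tau>) / (s * \<beta>) * expectation (\<lambda>\<omega>. (norm (lam_step (Suc k) \<omega>))\<^sup>2)
   \<le> (1 + \<tau>) / (s * \<beta> * \<sigma>A) * \<gamma> * (expectation (\<lambda>\<omega>. (norm (AT (lam_step k \<omega>)))\<^sup>2)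
          - expectation (\<lambda>\<omega>. (norm (AT (lam_step (Suc k) \<omega>)))\<^sup>2))
     + \<delta> * (2 * Lf\<^sup>2 * expectation (\<lambda>\<omega>. (norm (x_step (Suc k) \<omega>))\<^sup>2)
          + 4 * expectation (\<lambda>\<omega>. (norm (x_error (Suc k) \<omega>))\<^sup>2)
          + 4 * expectation (\<lambda>\<omega>. (norm (x_error k \<omega>))\<^sup>2))"
proof -
  let ?A = "\<lambda>k \<omega>. (norm (AT (lam_step k \<omega>)))\<^sup>2"
  let ?D = "\<lambda>\<omega>. (norm (lam_step (Suc k) \<omega>))\<^sup>2"
  let ?R = "\<lambda>\<omega>. 2 * Lf\<^sup>2 * (norm (x_step (Suc k) \<omega>))\<^sup>2
    + 4 * (norm (x_error (Suc k) \<omega>))\<^sup>2 + 4 * (norm (x_error k \<omega>))\<^sup>2"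
  let ?c = "(1 + \<tau>) / (s * \<beta> * \<sigma>A)"
  have c: "0 \<le> ?c" using s_pos \<beta>_pos \<tau>_pos \<sigma>A_pos by simp
  have "\<sigma>A * ?D \<omega> \<le> \<gamma> * (?A k \<omega> - ?A (Suc k) \<omega>) + psi1 s * ?R \<omega>" if "\<omega> \<in> space P" for \<omega>
    using lam_step_norm_le[OF that, of "Suc k"] lam_step_bound[of k \<omega>] by linarith
  then have "expectation (\<lambda>\<omega>. \<sigma>A * ?D \<omega>)
      \<le> expectation (\<lambda>\<omega>. \<gamma> * (?A k \<omega> - ?A (Suc k) \<omega>) + psi1 s * ?R \<omega>)"
    by (intro integral_mono Bochner_Integration.integrable_add Bochner_Integration.integrable_diff
        integrable_mult_right integrable_lam_step integrable_transpose_lam_step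
        integrable_primal_steps integrable_x_error)
  also have "\<dots> = \<gamma> * (expectation (?A k) - expectation (?A (Suc k)))
     + psi1 s * (2 * Lf\<^sup>2 * expectation (\<lambda>\<omega>. (norm (x_step (Suc k) \<omega>))\<^sup>2)
          + 4 * expectation (\<lambda>\<omega>. (norm (x_error (Suc k) \<omega>))\<^sup>2)
          + 4 * expectation (\<lambda>\<omega>. (norm (x_error k \<omega>))\<^sup>2))" (is "_ = ?r")
    by (simp add: integrable_transpose_lam_step integrable_primal_steps integrable_x_error
        del: transpose_matrix_vector)
  finally have "?c * (\<sigma>A * expectation ?D) \<le> ?c * ?r"
    using c by (intro mult_left_mono) simp_all
  then show ?thesis
    using \<sigma>A_pos unfolding dual_weight_def
    by (simp only: distrib_left mult.assoc[symmetric]) (simp del: transpose_matrix_vector)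
qed

text \<open>The second summand absorbs the telescoping term of the multiplier recursion, the third one the
  gradient error of iteration \<open>k\<close> that enters the estimate for iteration \<open>k + 1\<close>.\<close>

definition "potential k = expectation (lagr k)
  + (1 + \<tau>) / (s * \<beta> * \<sigma>A) * \<gamma> * expectation (\<lambda>\<omega>. (norm (AT (lam_step k \<omega>)))\<^sup>2)
  + 4 * \<delta> * expectation (\<lambda>\<omega>. (norm (x_error k \<omega>))\<^sup>2)"

lemma potential_ge: "Llow \<le> potential k"
proof -
  have "expectation (\<lambda>_. Llow) \<le> expectation (lagr k)"
    by (intro integral_mono_AE integrable_lagr) (use bounded_below in auto)
  moreover have "0 \<le> (1 + \<tau>) / (s * \<beta> * \<sigma>A) * \<gamma> * expectation (\<lambda>\<omega>. (norm (AT (lam_step k \<omega>)))\<^sup>2)"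
    using s_pos \<beta>_pos \<tau>_pos \<sigma>A_pos \<gamma>_nonneg by (intro mult_nonneg_nonneg integral_nonneg) auto
  moreover have "0 \<le> 4 * \<delta> * expectation (\<lambda>\<omega>. (norm (x_error k \<omega>))\<^sup>2)"
    using dual_weight_nonneg by (intro mult_nonneg_nonneg integral_nonneg) auto
  ultimately show ?thesis by (simp add: potential_def prob_space)
qed

lemma potential_0: "potential 0 = aug_lagrangian f g A B b \<beta> x0 y0 lam0
  + 4 * \<delta> * (norm (grad f x0 - AT lam0))\<^sup>2"
proof -
  have "expectation (lagr 0) = expectation (\<lambda>_. aug_lagrangian f g A B b \<beta> x0 y0 lam0)"
    by (rule Bochner_Integration.integral_cong) (auto simp: init)
  moreover have "expectation (\<lambda>\<omega>. (norm (x_error 0 \<omega>))\<^sup>2) = expectation (\<lambda>_. (norm (grad f x0 - AT lam0))\<^sup>2)"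
    by (rule Bochner_Integration.integral_cong) (auto simp: x_error_0)
  ultimately show ?thesis by (simp add: potential_def prob_space)
qed

text \<open>The multiplier estimate charges \<open>4 \<delta>\<close> for the gradient error of either iteration. The part from
  iteration \<open>k\<close> cancels against the potential there, and the part from iteration \<open>k + 1\<close> doubles to
  \<open>8 \<delta>\<close> because the new potential contains it too. The gradient criterion turns this into
  \<open>8 \<delta> (cx \<beta>)\<^sup>2\<close> times the squared primal increments, which is what the coefficients in
  \<open>expectation_lagr_descent\<close> exceed by \<open>w\<close>, once the Lipschitz term is counted for \<open>x\<close>.\<close>

lemma potential_descent:
  "potential (Suc k)
    + (w * (expectation (\<lambda>\<omega>. (norm (x_step (Suc k) \<omega>))\<^sup>2) + expectation (\<lambda>\<omega>. (norm (y_step (Suc k) \<omega>))\<^sup>2))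
       + \<tau> / (s * \<beta>) * expectation (\<lambda>\<omega>. (norm (lam_step (Suc k) \<omega>))\<^sup>2))
   \<le> potential k + ((cx' * \<beta>)\<^sup>2 / 2 + 8 * \<delta> * (cx * \<beta>)\<^sup>2) * (\<sigma>\<^sup>2 / real M)"
proof -
  define X Y D Z where "X = expectation (\<lambda>\<omega>. (norm (x_step (Suc k) \<omega>))\<^sup>2)"
    and "Y = expectation (\<lambda>\<omega>. (norm (y_step (Suc k) \<omega>))\<^sup>2)"
    and "D = expectation (\<lambda>\<omega>. (norm (lam_step (Suc k) \<omega>))\<^sup>2)"
    and "Z = expectation (\<lambda>\<omega>. (norm (x_error (Suc k) \<omega>))\<^sup>2)"
  note defs = X_def[symmetric] Y_def[symmetric] D_def[symmetric] Z_def[symmetric]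
  have "8 * \<delta> * Z \<le> 8 * \<delta> * ((cx * \<beta>)\<^sup>2 * (\<sigma>\<^sup>2 / real M + X + Y))"
    using expectation_x_error_le[of k, unfolded defs] dual_weight_nonneg
    by (intro mult_left_mono) auto
  moreover have "(1 + \<tau>) / (s * \<beta>) * D = 1 / (s * \<beta>) * D + \<tau> / (s * \<beta>) * D"
    by (simp add: add_divide_distrib distrib_right)
  ultimately show ?thesis
    using expectation_lagr_descent[of k, unfolded defs] expectation_lam_step_le[of k, unfolded defs]
    unfolding potential_def defs right_diff_distrib distrib_left distrib_right mult.assoc
    by (simp only: mult.assoc mult.commute mult.left_commute)
qed

text \<open>The right-hand side is the same for all runs, batch sizes and \<open>T\<close>: the initial potential is
  deterministic, each iteration contributes noise of order \<open>1 / M\<close>, and \<open>T / M \<le> \<kappa>\<close>.\<close>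

lemma sum_expectation_step_errors_le:
  assumes "real T \<le> \<kappa> * real M"
  shows "(\<Sum>k=1..T. expectation (step_errors k))
    \<le> \<kappa> * (cx * \<beta>)\<^sup>2 * \<sigma>\<^sup>2 + ((1 + (cx * \<beta>)\<^sup>2) / w + s * \<beta> / \<tau>) *
        (aug_lagrangian f g A B b \<beta> x0 y0 lam0 + 4 * \<delta> * (norm (grad f x0 - AT lam0))\<^sup>2 - Llow
         + \<kappa> * ((cx' * \<beta>)\<^sup>2 / 2 + 8 * \<delta> * (cx * \<beta>)\<^sup>2) * \<sigma>\<^sup>2)"
proof -
  define X Y D Z where "X k = expectation (\<lambda>\<omega>. (norm (x_step k \<omega>))\<^sup>2)"
    and "Y k = expectation (\<lambda>\<omega>. (norm (y_step k \<omega>))\<^sup>2)"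
    and "D k = expectation (\<lambda>\<omega>. (norm (lam_step k \<omega>))\<^sup>2)"
    and "Z k = expectation (\<lambda>\<omega>. (norm (x_error k \<omega>))\<^sup>2)" for k
  note defs = X_def[symmetric] Y_def[symmetric] D_def[symmetric] Z_def[symmetric]
  have nonneg: "0 \<le> X k" "0 \<le> Y k" "0 \<le> D k" for k
    by (auto simp: X_def Y_def D_def)
  \<comment> \<open>The first summand of \<open>q\<close> restores the primal increments and the gradient error dominated by
    them, the second one the multiplier increments.\<close>
  define q where "q = (1 + (cx * \<beta>)\<^sup>2) / w + s * \<beta> / \<tau>"
  define r where "r k = w * (X k + Y k) + \<tau> / (s * \<beta>) * D k" for k
  define e where "e = ((cx' * \<beta>)\<^sup>2 / 2 + 8 * \<delta> * (cx * \<beta>)\<^sup>2) * \<sigma>\<^sup>2"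
  have q_nonneg: "0 \<le> q" using w_pos s_pos \<beta>_pos \<tau>_pos by (simp add: q_def)
  have e_nonneg: "0 \<le> e" using dual_weight_nonneg by (simp add: e_def)
  have TM: "real T / real M \<le> \<kappa>" using assms batch_size by (simp add: field_simps)
  have per_step: "expectation (step_errors k) \<le> (cx * \<beta>)\<^sup>2 * \<sigma>\<^sup>2 / real M + q * r k" if pos: "1 \<le> k" for k
  proof -
    obtain j where k: "k = Suc j" using pos by (cases k) auto
    have "expectation (step_errors k) = Z k + X k + Y k + D k"
      unfolding step_errors_def[abs_def] X_def Y_def D_def Z_def k
      by (simp add: integrable_x_error integrable_primal_steps integrable_lam_step)
    also have "Z k \<le> (cx * \<beta>)\<^sup>2 * (\<sigma>\<^sup>2 / real M + X k + Y k)"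
      using expectation_x_error_le[of j] by (simp add: X_def Y_def Z_def k)
    finally have "expectation (step_errors k)
        \<le> (cx * \<beta>)\<^sup>2 * \<sigma>\<^sup>2 / real M + (1 + (cx * \<beta>)\<^sup>2) * (X k + Y k) + D k"
      by (simp add: algebra_simps)
    moreover have "q * r k = (1 + (cx * \<beta>)\<^sup>2) * (X k + Y k) + D k
        + ((1 + (cx * \<beta>)\<^sup>2) / w * (\<tau> / (s * \<beta>)) * D k + s * \<beta> / \<tau> * (w * (X k + Y k)))"
    proof -
      have "(1 + (cx * \<beta>)\<^sup>2) / w * (w * (X k + Y k)) = (1 + (cx * \<beta>)\<^sup>2) * (X k + Y k)"
        "s * \<beta> / \<tau> * (\<tau> / (s * \<beta>) * D k) = D k"
        using w_pos s_pos \<beta>_pos \<tau>_pos by simp_all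
      then show ?thesis
        unfolding q_def r_def distrib_right[of _ _ "_ * _ + _ * _"] distrib_left[of "_ / _"]
        by (simp only: mult.assoc)
    qed
    moreover have "0 \<le> (1 + (cx * \<beta>)\<^sup>2) / w * (\<tau> / (s * \<beta>)) * D k + s * \<beta> / \<tau> * (w * (X k + Y k))"
      using nonneg w_pos s_pos \<beta>_pos \<tau>_pos by simp
    ultimately show ?thesis by linarith
  qed
  have "potential T + (\<Sum>k=1..T. r k) \<le> potential 0 + real T * (e / real M)"
    using potential_descent by (intro sum_le_of_descent) (simp add: r_def e_def X_def Y_def D_def)
  then have "(\<Sum>k=1..T. r k) \<le> potential 0 - Llow + real T / real M * e"
    using potential_ge[of T] by simp
  also have "\<dots> \<le> potential 0 - Llow + \<kappa> * e"
    by (intro add_left_mono mult_right_mono TM e_nonneg)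
  finally have sum_r: "q * (\<Sum>k=1..T. r k) \<le> q * (potential 0 - Llow + \<kappa> * e)"
    using q_nonneg by (rule mult_left_mono)
  have "(\<Sum>k=1..T. expectation (step_errors k))
      \<le> (\<Sum>k=1..T. (cx * \<beta>)\<^sup>2 * \<sigma>\<^sup>2 / real M + q * r k)"
    by (intro sum_mono per_step) simp
  also have "\<dots> = real T / real M * ((cx * \<beta>)\<^sup>2 * \<sigma>\<^sup>2) + q * (\<Sum>k=1..T. r k)"
    by (simp add: sum.distrib sum_distrib_left)
  also have "\<dots> \<le> \<kappa> * ((cx * \<beta>)\<^sup>2 * \<sigma>\<^sup>2) + q * (potential 0 - Llow + \<kappa> * e)"
    using TM sum_r by (intro add_mono mult_right_mono) auto
  finally show ?thesis by (simp add: potential_0 q_def e_def mult.assoc)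
qed

end

section \<open>The convergence rate\<close>

theorem theorem1:
  fixes f :: "real ^ 'nx \<Rightarrow> real" and fi :: "nat \<Rightarrow> real ^ 'nx \<Rightarrow> real" and N :: nat
    and g :: "real ^ 'ny \<Rightarrow> real"
    and A :: "real ^ 'nx ^ 'm" and B :: "real ^ 'ny ^ 'm" and b :: "real ^ 'm"
    and G :: "real ^ 'nx \<Rightarrow> 's \<Rightarrow> real ^ 'nx" and \<Xi> :: "'s measure"
    and \<beta> s cx cx' cy \<sigma> Lf w \<tau> \<sigma>A Ahat Llow \<kappa> :: real
    and x0 :: "real ^ 'nx" and y0 :: "real ^ 'ny" and lam0 :: "real ^ 'm"
  assumes "1 \<le> N" and "f = (\<lambda>x. (1 / real N) * (\<Sum>i<N. fi i x))"
    and "\<forall>x. f differentiable (at x)"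
    and "locally_lipschitz g"
    and A1: "0 < Lf" "Lf-lipschitz_on UNIV (grad f)"
    and "prob_space \<Xi>" and "0 < \<sigma>"
    and A3: "range ((*v) B) \<union> {b} \<subseteq> range ((*v) A)"
    and "A \<noteq> 0" and "\<sigma>A = smallest_pos_eigenvalue (transpose A ** A)"
    and "0 < \<beta>" "0 < s" "s < 2" "0 < cx" "0 < cx'" "0 < cy"
    and "0 < w" "0 < \<tau>" "\<tau> < 1"
    and "Ahat = 4 * ((1 + \<tau>) / (s * \<beta> * \<sigma>A)) * psi1 s * cx\<^sup>2 * \<beta>\<^sup>2"
    and "0 < \<kappa>"
  shows "\<exists>C. \<forall>(P :: 'p measure) F M \<zeta> x y lam Dx Dy (T::nat).
           unified_admm f g A B b \<beta> s cx cx' cy \<sigma> G \<Xi> x0 y0 lam0 P F M \<zeta> x y lam Dx Dy \<longrightarrow>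
           bounded_variance_oracle f G \<Xi> \<sigma> M \<longrightarrow>
           (AE \<omega> in P. \<forall>k. Llow \<le> aug_lagrangian f g A B b \<beta> (x k \<omega>) (y k \<omega>) (lam k \<omega>)) \<longrightarrow>
           (\<forall>k. \<forall>\<omega>\<in>space P. invertible (Dx k \<omega>) \<and> invertible (Dy k \<omega>)) \<longrightarrow>
           (\<forall>k. \<forall>\<omega>\<in>space P.
              (1 + \<tau>) / (s * \<beta> * \<sigma>A) * psi1 s * (2 * Lf\<^sup>2 + 4 * cx\<^sup>2 * \<beta>\<^sup>2) + Ahat
                - \<beta> / 2 * smallest_pos_eigenvalue (Dx k \<omega>) \<le> - w \<and>
              2 * Ahat - \<beta> / 2 * smallest_pos_eigenvalue (Dy k \<omega>) \<le> - w) \<longrightarrow>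
           1 \<le> T \<longrightarrow> real T \<le> \<kappa> * real M \<longrightarrow>
           (MIN k\<in>{1..T}. \<integral>\<^sup>+\<omega>. ennreal ((infdist 0
               (subdiff_aug_lagrangian f g A B b \<beta> (x k \<omega>) (y k \<omega>) (lam k \<omega>)))\<^sup>2) \<partial>P)
             \<le> ennreal (C / real T)"
proof -
  define \<delta> where "\<delta> = dual_weight A \<beta> s \<tau>"
  define K where "K = stationarity_factor A B \<beta> s cy"
  define S where "S = \<kappa> * (cx * \<beta>)\<^sup>2 * \<sigma>\<^sup>2 + ((1 + (cx * \<beta>)\<^sup>2) / w + s * \<beta> / \<tau>) *
        (aug_lagrangian f g A B b \<beta> x0 y0 lam0
         + 4 * \<delta> * (norm (grad f x0 - transpose A *v lam0))\<^sup>2 - Llow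
         + \<kappa> * ((cx' * \<beta>)\<^sup>2 / 2 + 8 * \<delta> * (cx * \<beta>)\<^sup>2) * \<sigma>\<^sup>2)"
  have Ahat: "Ahat = 4 * \<delta> * (cx * \<beta>)\<^sup>2"
    using assms by (simp add: \<delta>_def dual_weight_def power_mult_distrib)
  \<comment> \<open>\<open>K\<close> and \<open>S\<close> are fixed before the run is: the constant must serve all runs at once.\<close>
  show ?thesis
  proof (intro exI[of _ "K * S"] allI impI)
    fix P :: "'p measure" and F M \<zeta> x y lam Dx Dy and T :: nat
    assume admm: "unified_admm f g A B b \<beta> s cx cx' cy \<sigma> G \<Xi> x0 y0 lam0 P F M \<zeta> x y lam Dx Dy"
      and below: "AE \<omega> in P. \<forall>k. Llow \<le> aug_lagrangian f g A B b \<beta> (x k \<omega>) (y k \<omega>) (lam k \<omega>)"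
      and inv: "\<forall>k. \<forall>\<omega>\<in>space P. invertible (Dx k \<omega>) \<and> invertible (Dy k \<omega>)"
      and dom: "\<forall>k. \<forall>\<omega>\<in>space P.
              (1 + \<tau>) / (s * \<beta> * \<sigma>A) * psi1 s * (2 * Lf\<^sup>2 + 4 * cx\<^sup>2 * \<beta>\<^sup>2) + Ahat
                - \<beta> / 2 * smallest_pos_eigenvalue (Dx k \<omega>) \<le> - w \<and>
              2 * Ahat - \<beta> / 2 * smallest_pos_eigenvalue (Dy k \<omega>) \<le> - w"
      and T: "1 \<le> T" and TM: "real T \<le> \<kappa> * real M"
    have dom': "\<delta> * (2 * Lf\<^sup>2 + 8 * (cx * \<beta>)\<^sup>2) + w \<le> \<beta> / 2 * smallest_pos_eigenvalue (Dx k \<omega>)"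
      "8 * \<delta> * (cx * \<beta>)\<^sup>2 + w \<le> \<beta> / 2 * smallest_pos_eigenvalue (Dy k \<omega>)"
      if \<omega>: "\<omega> \<in> space P" for k \<omega>
    proof -
      have "\<delta> * (2 * Lf\<^sup>2 + 4 * (cx * \<beta>)\<^sup>2) + Ahat
          - \<beta> / 2 * smallest_pos_eigenvalue (Dx k \<omega>) \<le> - w"
        "2 * Ahat - \<beta> / 2 * smallest_pos_eigenvalue (Dy k \<omega>) \<le> - w"
        using dom \<omega> by (simp_all add: \<delta>_def dual_weight_def assms(11) power_mult_distrib mult.assoc)
      then show "\<delta> * (2 * Lf\<^sup>2 + 8 * (cx * \<beta>)\<^sup>2) + w \<le> \<beta> / 2 * smallest_pos_eigenvalue (Dx k \<omega>)"
        "8 * \<delta> * (cx * \<beta>)\<^sup>2 + w \<le> \<beta> / 2 * smallest_pos_eigenvalue (Dy k \<omega>)"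
        unfolding Ahat by (simp_all add: algebra_simps)
    qed
    interpret prox_dominated_admm f g A B b \<beta> s cx cx' cy \<sigma> G \<Xi> x0 y0 lam0 P F M \<zeta> x y lam Dx Dy Lf w \<tau> Llow
      by (rule prox_dominated_admm.intro[OF admm], unfold_locales)
        (use assms below inv dom'[unfolded \<delta>_def] in auto)
    define I where "I k = (\<integral>\<^sup>+\<omega>. ennreal ((infdist 0
               (subdiff_aug_lagrangian f g A B b \<beta> (x k \<omega>) (y k \<omega>) (lam k \<omega>)))\<^sup>2) \<partial>P)" for k
    have I_le: "I k \<le> ennreal (K * expectation (step_errors k))" if "k \<in> {1..T}" for k
    proof -
      obtain j where j: "k = Suc j" using \<open>k \<in> {1..T}\<close> by (cases k) auto
      have int: "integrable P (step_errors k)"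
        unfolding j by (rule integrable_step_errors)
      have "I k \<le> (\<integral>\<^sup>+\<omega>. ennreal (K * step_errors k \<omega>) \<partial>P)"
        unfolding I_def j K_def by (intro nn_integral_mono ennreal_leI infdist_le_step_errors)
      also have "\<dots> = ennreal (\<integral>\<omega>. K * step_errors k \<omega> \<partial>P)"
        by (intro nn_integral_eq_integral integrable_mult_right int AE_I2 mult_nonneg_nonneg)
          (auto simp: K_def stationarity_factor_nonneg step_errors_def)
      finally show ?thesis by simp
    qed
    have "(\<Sum>k=1..T. expectation (step_errors k)) \<le> S"
      using sum_expectation_step_errors_le[OF TM] by (simp only: S_def \<delta>_def)
    then have "\<exists>k\<in>{1..T}. expectation (step_errors k) \<le> S / real T"
    proof (rule contrapos_pp)
      assume "\<not> (\<exists>k\<in>{1..T}. expectation (step_errors k) \<le> S / real T)"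
      then have "(\<Sum>k=1..T. S / real T) < (\<Sum>k=1..T. expectation (step_errors k))"
        using T by (intro sum_strict_mono) (auto simp: not_le)
      then show "\<not> (\<Sum>k=1..T. expectation (step_errors k)) \<le> S"
        using T by simp
    qed
    then obtain k where k: "k \<in> {1..T}" and small: "expectation (step_errors k) \<le> S / real T" ..
    have "(MIN k\<in>{1..T}. I k) \<le> I k" using k by (intro Min_le) auto
    also have "\<dots> \<le> ennreal (K * expectation (step_errors k))" using k by (rule I_le)
    also have "\<dots> \<le> ennreal (K * (S / real T))"
      using small by (intro ennreal_leI mult_left_mono) (simp_all add: K_def stationarity_factor_nonneg)
    finally show "(MIN k\<in>{1..T}. \<integral>\<^sup>+\<omega>. ennreal ((infdist 0
               (subdiff_aug_lagrangian f g A B b \<beta> (x k \<omega>) (y k \<omega>) (lam k \<omega>)))\<^sup>2) \<partial>P)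
             \<le> ennreal (K * S / real T)"
      by (simp add: I_def)
  qed
qed

end
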